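(* Let $f:\mathbb{R}^d\to\mathbb{R}$ be twice continuously differentiable with minimizer $x_*$, and suppose there are constants $\mu,L,M>0$ such that: $f$ is strongly convex with parameter $\mu$; $\|\nabla f(x)-\nabla f(y)\|\le L\|x-y\|$ for all $x,y\in\mathbb{R}^d$; and $\|\nabla^2 f(x)-\nabla^2 f(x_* )\|\le M\|x-x_*\|$ for all $x\in\mathbb{R}^d$. Let $\alpha>0$, and let $\{x_k\}_{k\ge0}$ be the iterates generated by the BFGS method with exact line search from an arbitrary initial point $x_0\in\mathbb{R}^d$ and initial matrix $B_0=\alpha I$, and assume $x_k\ne x_*$ for all $k\ge0$. Set $\kappa=L/\mu$ and $C_0=\frac{2M}{\mu^{3/2}}\sqrt{2(f(x_0)-f(x_* ))}$. Then for every $k\ge1$, $$\frac{f(x_k)-f(x_* )}{f(x_0)-f(x_* )}\le\left(\frac{d\left(\frac\alpha\mu-1+\log\frac L\alpha\right)+4C_0d\left(\frac\alpha L-1+\log\frac L\alpha\right)+12C_0\kappa\min\{2(1+C_0),\,1+\sqrt\kappa\}}{k}\right)^k.$$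
   Context: $\|\cdot\|$ is the Euclidean norm of vectors and the spectral norm of matrices; $\log$ is the natural logarithm. Since $f$ is twice differentiable, strong convexity with parameter $\mu$ and $L$-Lipschitz gradient mean $\mu I\preceq\nabla^2 f(x)\preceq LI$ for all $x$. BFGS method with exact line search: given $x_0\in\mathbb{R}^d$ and symmetric positive definite $B_0$, for $k\ge0$ put $g_k=\nabla f(x_k)$, $d_k=-B_k^{-1}g_k$, $\eta_k=\arg\min_{\eta\ge0}f(x_k+\eta d_k)$, $x_{k+1}=x_k+\eta_kd_k$, $s_k=x_{k+1}-x_k$, $y_k=\nabla f(x_{k+1})-\nabla f(x_k)$, and $$B_{k+1}=B_k-\frac{B_ks_ks_k^\top B_k}{s_k^\top B_ks_k}+\frac{y_ky_k^\top}{s_k^\top y_k}.$$ All $B_k$ are then symmetric positive definite. The standing assumption that $x_k\neq x_*$ for all $k$ ensures that all quantities are well defined. *)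

theory Defs
  imports "HOL-Analysis.Analysis"
begin

definition grad :: "('a::real_inner \<Rightarrow> real) \<Rightarrow> 'a \<Rightarrow> 'a" where
  "grad f x = (THE g. GDERIV f x :> g)"

definition hess :: "(real ^ 'n \<Rightarrow> real) \<Rightarrow> real ^ 'n \<Rightarrow> real ^ 'n ^ 'n" where
  "hess f x = matrix (frechet_derivative (grad f) (at x))"

definition twice_cont_diff :: "(real ^ 'n \<Rightarrow> real) \<Rightarrow> bool" where
  "twice_cont_diff f \<longleftrightarrow>
     (\<forall>x. f differentiable (at x)) \<and> (\<forall>x. grad f differentiable (at x)) \<and>
     continuous_on UNIV (hess f)"

lemma GDERIV_unique:
  assumes "GDERIV f x :> g" "GDERIV f x :> h"
  shows "g = h"
proof -
  have "(\<lambda>v. v \<bullet> g) = (\<lambda>v. v \<bullet> h)"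
    using assms has_derivative_unique unfolding gderiv_def by blast
  then show ?thesis by (metis vector_eq_ldot)
qed

lemma grad_eqI: "GDERIV f x :> g \<Longrightarrow> grad f x = g"
  unfolding grad_def using GDERIV_unique by blast

lemma GDERIV_grad:
  fixes f :: "'a::euclidean_space \<Rightarrow> real"
  assumes "f differentiable (at x)"
  shows "GDERIV f x :> grad f x"
proof -
  obtain f' where f': "(f has_derivative f') (at x)"
    using assms unfolding differentiable_def by blast
  then interpret linear f' using has_derivative_linear by blast
  have "f' v = v \<bullet> adjoint f' 1" for v
    using adjoint_works[of f' v 1] linear_axioms by simp
  then have "f' = (\<lambda>v. v \<bullet> adjoint f' 1)" by auto
  with f' have "GDERIV f x :> adjoint f' 1" unfolding gderiv_def by simp
  with grad_eqI show ?thesis by metis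
qed

lemma has_derivative_hess:
  assumes "grad f differentiable (at x)"
  shows "(grad f has_derivative (\<lambda>h. hess f x *v h)) (at x)"
proof -
  have "(grad f has_derivative frechet_derivative (grad f) (at x)) (at x)"
    using assms frechet_derivative_works by blast
  moreover from this have "linear (frechet_derivative (grad f) (at x))"
    by (rule has_derivative_linear)
  ultimately show ?thesis
    unfolding hess_def by (simp add: matrix_works)
qed

definition strongly_convex :: "real \<Rightarrow> ('a::real_normed_vector \<Rightarrow> real) \<Rightarrow> bool" where
  "strongly_convex \<mu> f \<longleftrightarrow>
     (\<forall>x y t. 0 \<le> t \<and> t \<le> 1 \<longrightarrow>
        f (t *\<^sub>R x + (1 - t) *\<^sub>R y)
          \<le> t * f x + (1 - t) * f y - \<mu> / 2 * t * (1 - t) * (norm (x - y))\<^sup>2)"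

(* The library norm on real ^ 'n ^ 'm is the Frobenius norm, hence the operator norm here. *)
definition spectral_norm :: "real ^ 'n ^ 'm \<Rightarrow> real" where
  "spectral_norm A = onorm ((*v) A)"

definition outer :: "real ^ 'm \<Rightarrow> real ^ 'n \<Rightarrow> real ^ 'n ^ 'm" where
  "outer u v = (\<chi> i j. u $ i * v $ j)"

definition bfgs_update ::
  "real ^ 'n ^ 'n \<Rightarrow> real ^ 'n \<Rightarrow> real ^ 'n \<Rightarrow> real ^ 'n ^ 'n" where
  "bfgs_update B s y =
     B - (1 / (s \<bullet> (B *v s))) *\<^sub>R (B ** outer s s ** B) + (1 / (s \<bullet> y)) *\<^sub>R outer y y"

definition bfgs_exact ::
  "(real ^ 'n \<Rightarrow> real) \<Rightarrow> (nat \<Rightarrow> real ^ 'n) \<Rightarrow> (nat \<Rightarrow> real ^ 'n ^ 'n) \<Rightarrow> bool" where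
  "bfgs_exact f x B \<longleftrightarrow>
     (\<forall>k. let d = - (matrix_inv (B k) *v grad f (x k)) in
        (\<exists>\<eta>. is_arg_min (\<lambda>\<eta>. f (x k + \<eta> *\<^sub>R d)) (\<lambda>\<eta>. 0 \<le> \<eta>) \<eta> \<and>
             x (Suc k) = x k + \<eta> *\<^sub>R d) \<and>
        B (Suc k) =
          bfgs_update (B k) (x (Suc k) - x k) (grad f (x (Suc k)) - grad f (x k)))"

end

theory Submission
  imports Defs
begin

text \<open>
  Why the rate holds. Let \<open>r\<^sub>i\<close> be the factor by which the optimality gap shrinks in iteration \<open>i\<close>.
  The gap ratio after \<open>k\<close> iterations is the product of \<open>r\<^sub>0, ..., r\<^sub>k\<^sub>-\<^sub>1\<close>, hence by the inequality of
  the arithmetic and the geometric mean at most \<open>(A / k) ^ k\<close> for every upper bound \<open>A\<close> of the sum of the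
  \<open>r\<^sub>i\<close>. So it suffices to bound that sum independently of \<open>k\<close> (\<open>sum_ratio_le\<close> and \<open>sum_hess_dev_le\<close>).

  The source of such a bound is the potential \<open>trace (W B) - ln det B\<close> of Byrd and Nocedal, for a fixed
  symmetric positive definite weight \<open>W\<close>. One BFGS update adds to it at most
  \<open>(y \<bullet> W y / s \<bullet> y - 1) + ln a\<close>, where the alignment \<open>a\<close> measures, in the metric of \<open>W\<close>, how well the
  step follows the negative gradient (\<open>potential_bfgs_update\<close>). The potential is bounded below by its
  value at the inverse of \<open>W\<close> (\<open>potential_minimal\<close>), so the sum of the \<open>ln a\<^sub>i\<close> is bounded below. An
  exact line search, in turn, makes \<open>1 - r\<^sub>i\<close> at least \<open>a\<^sub>i\<close> times a factor that depends only on the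
  conditioning of \<open>f\<close> relative to \<open>W\<close> (\<open>exact_step_decrease_ratio\<close>). Therefore the sum of the
  \<open>ln (1 - r\<^sub>i)\<close> is bounded below up to the curvature terms and the logarithms of the conditioning factors.

  Two weights are used. With \<open>W = I / L\<close> the curvature terms \<open>y \<bullet> W y / s \<bullet> y - 1\<close> are never positive and the
  conditioning factor is a constant; this gives linear convergence after a number of iterations governed by \<open>\<Psi>_L\<close>
  (\<open>gap_linear_decay\<close>). With \<open>W\<close> the inverse of the Hessian at the minimizer, every error in iteration
  \<open>i\<close> is of the order of \<open>hess_dev (x i)\<close>, the relative deviation of the Hessian, which is proportional to
  the square root of the gap; by linear convergence these errors are summable. As
  \<open>ln (1 - r\<^sub>i) \<le> - r\<^sub>i\<close>, the lower bound on the logarithms is the desired bound on the sum of the \<open>r\<^sub>i\<close>.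
\<close>

section \<open>Symmetric positive definite matrices\<close>

definition spd :: "real ^ 'n ^ 'n \<Rightarrow> bool" where
  "spd A \<longleftrightarrow> transpose A = A \<and> (\<forall>v. v \<noteq> 0 \<longrightarrow> 0 < v \<bullet> (A *v v))"

lemma spd_pos: "spd A \<Longrightarrow> v \<noteq> 0 \<Longrightarrow> 0 < v \<bullet> (A *v v)"
  by (simp add: spd_def)

lemma spd_nonneg: "spd A \<Longrightarrow> 0 \<le> v \<bullet> (A *v v)"
  by (cases "v = 0") (auto simp: spd_def less_imp_le)

lemma symmetric_inner:
  fixes A :: "real ^ 'n ^ 'n"
  assumes "transpose A = A"
  shows "u \<bullet> (A *v v) = (A *v u) \<bullet> v"
  using assms dot_lmul_matrix[of u A v] by (metis transpose_matrix_vector)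

lemma spd_inner: "spd A \<Longrightarrow> u \<bullet> (A *v v) = (A *v u) \<bullet> v"
  by (simp add: spd_def symmetric_inner)

lemma spd_invertible:
  assumes "spd A" shows "invertible A"
proof -
  have "v = 0" if "A *v v = 0" for v
    using spd_pos[OF assms, of v] that by auto
  then show ?thesis
    by (simp add: invertible_left_inverse matrix_left_invertible_ker)
qed

lemma spd_det_nonzero: "spd A \<Longrightarrow> det A \<noteq> 0"
  using spd_invertible invertible_det_nz by blast

lemma matrix_inv_right_inverse:
  fixes A :: "real ^ 'n ^ 'n"
  assumes "invertible A"
  shows "A ** matrix_inv A = mat 1"
  using someI_ex[OF assms[unfolded invertible_def]] by (simp add: matrix_inv_def)

lemma spd_scaleR_mat: "c > 0 \<Longrightarrow> spd (c *\<^sub>R mat 1 :: real ^ 'n ^ 'n)"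
  by (simp add: spd_def transpose_scalar transpose_mat scaleR_matrix_vector_assoc[symmetric])

lemma spd_cauchy_schwarz:
  assumes "spd A"
  shows "(u \<bullet> (A *v v))\<^sup>2 \<le> (u \<bullet> (A *v u)) * (v \<bullet> (A *v v))"
proof (cases "v = 0")
  case False
  define a b c where "a = u \<bullet> (A *v u)" and "b = u \<bullet> (A *v v)" and "c = v \<bullet> (A *v v)"
  have c: "c > 0" using spd_pos[OF assms False] by (simp add: c_def)
  have b': "v \<bullet> (A *v u) = b"
    by (metis assms b_def inner_commute spd_inner)
  have "0 \<le> (c *\<^sub>R u - b *\<^sub>R v) \<bullet> (A *v (c *\<^sub>R u - b *\<^sub>R v))"
    using spd_nonneg[OF assms] .
  also have "\<dots> = c * (c * a - b * b)"
    using b' by (simp add: matrix_vector_mult_diff_distrib matrix_vector_mult_scaleR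
      inner_diff_left inner_diff_right a_def[symmetric] b_def[symmetric] c_def[symmetric] algebra_simps)
  finally have "0 \<le> c * a - b * b" using c by (simp add: zero_le_mult_iff)
  then show ?thesis
    by (simp add: a_def[symmetric] b_def[symmetric] c_def[symmetric] power2_eq_square mult.commute)
qed simp

lemma outer_vec: "outer u v *v w = (v \<bullet> w) *\<^sub>R u"
  by (simp add: vec_eq_iff outer_def matrix_vector_mult_def inner_vec_def sum_distrib_left
      sum_distrib_right mult_ac)

lemma outer_congruence:
  "A ** outer u v ** B = outer (A *v u) (transpose B *v v)"
  unfolding matrix_eq
  by (simp add: matrix_vector_mul_assoc[symmetric] outer_vec matrix_vector_mult_scaleR)
     (metis dot_lmul_matrix transpose_matrix_vector transpose_transpose)

lemma trace_mult_outer: "trace (W ** outer a b) = b \<bullet> (W *v a)"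
  by (simp add: trace_def matrix_matrix_mult_def outer_def inner_vec_def matrix_vector_mult_def
      sum_distrib_left mult_ac)

lemma det_scaleR_mat: "det (c *\<^sub>R mat 1 :: real ^ 'n ^ 'n) = c ^ CARD('n)"
  by (subst det_diagonal) (simp_all add: mat_def)

text \<open>
  An orthogonal change of basis that takes \<open>v\<close> to a multiple of a coordinate vector turns the matrix into the
  identity with one column replaced, whose determinant is one entry of that column.
\<close>

lemma det_mat_plus_outer: "det (mat 1 + outer u v :: real ^ 'n ^ 'n) = 1 + u \<bullet> v"
proof (cases "v = 0")
  case True
  then have "mat 1 + outer u v = mat 1" by (simp add: vec_eq_iff outer_def)
  then show ?thesis using True by simp
next
  case False
  fix k :: 'n
  define e :: "real ^ 'n" where "e = axis k 1"
  obtain T where T: "orthogonal_transformation T" and Te: "T ((1 / norm v) *\<^sub>R v) = e"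
    using orthogonal_transformation_exists_1[of "(1 / norm v) *\<^sub>R v" e] False
    by (auto simp: e_def)
  have lin: "linear T" using T by (simp add: orthogonal_transformation_linear)
  have Tv: "T v = norm v *\<^sub>R e"
    using Te[symmetric] lin False by (simp add: linear_cmul)
  define P where "P = matrix T"
  have P: "P *v w = T w" for w by (simp add: P_def lin matrix_works)
  have "orthogonal_matrix P"
    using T by (simp add: P_def orthogonal_transformation_matrix)
  then have PP: "P ** transpose P = mat 1" by (simp add: orthogonal_matrix_def)
  define z where "z = norm v *\<^sub>R T u"
  have "P ** (mat 1 + outer u v) ** transpose P = mat 1 + outer (T u) (T v)"
    unfolding matrix_eq using PP P linear_add[OF lin] linear_scale[OF lin]
    by (simp add: matrix_vector_mul_assoc[symmetric] matrix_vector_mult_add_rdistrib outer_vec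
        matrix_vector_right_distrib matrix_vector_mult_scaleR)
       (metis P dot_lmul_matrix matrix_vector_mul_assoc matrix_vector_mul_lid
         transpose_matrix_vector transpose_transpose)
  also have "\<dots> = (\<chi> i j. if j = k then (mat 1 *v (e + z)) $ i else (mat 1 :: real ^ 'n ^ 'n) $ i $ j)"
    unfolding Tv z_def matrix_vector_mul_lid
    by (auto simp: vec_eq_iff outer_def e_def axis_def mat_def)
  finally have "det (P ** (mat 1 + outer u v) ** transpose P) = (e + z) $ k"
    by (simp only: cramer_lemma) simp
  moreover have "det (P ** (mat 1 + outer u v) ** transpose P) = det (mat 1 + outer u v)"
  proof -
    have "det P * det (transpose P) = 1" using PP by (metis det_I det_mul)
    then show ?thesis by (simp add: det_mul)
  qed
  moreover have "(e + z) $ k = 1 + T u \<bullet> T v"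
    by (simp add: z_def Tv e_def inner_axis)
  ultimately show ?thesis using T by (simp add: orthogonal_transformation_def)
qed

section \<open>The BFGS update\<close>

lemma bfgs_update_eq:
  assumes "transpose B = B"
  shows "bfgs_update B s y = B - (1 / (s \<bullet> (B *v s))) *\<^sub>R outer (B *v s) (B *v s)
    + (1 / (s \<bullet> y)) *\<^sub>R outer y y"
  by (simp add: bfgs_update_def outer_congruence assms)

lemma bfgs_update_vec:
  assumes "transpose B = B"
  shows "bfgs_update B s y *v v = B *v v - ((B *v s) \<bullet> v / (s \<bullet> (B *v s))) *\<^sub>R (B *v s)
    + (y \<bullet> v / (s \<bullet> y)) *\<^sub>R y"
  by (simp add: bfgs_update_eq[OF assms] matrix_vector_mult_add_rdistrib
      matrix_vector_mult_diff_rdistrib scaleR_matrix_vector_assoc[symmetric] outer_vec)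

lemma bfgs_update_secant:
  assumes "spd B" "0 < s \<bullet> y"
  shows "bfgs_update B s y *v s = y"
proof -
  have "s \<noteq> 0" using assms(2) by auto
  then have "s \<bullet> (B *v s) \<noteq> 0" using spd_pos[OF assms(1)] by fastforce
  then show ?thesis
    using assms by (simp add: bfgs_update_vec spd_def inner_commute)
qed

text \<open>
  The update is a congruence of \<open>B\<close> by a rank-one perturbation of the identity. This yields both its
  determinant and the preservation of positive definiteness.
\<close>

lemma bfgs_update_product_form:
  fixes B :: "real ^ 'n ^ 'n"
  assumes B: "spd B" and sy: "0 < s \<bullet> y"
  defines "w \<equiv> (1 / sqrt ((s \<bullet> y) * (s \<bullet> (B *v s)))) *\<^sub>R y - (1 / (s \<bullet> (B *v s))) *\<^sub>R (B *v s)"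
  shows "bfgs_update B s y = (mat 1 + outer w s) ** B ** (mat 1 + outer s w)"
proof -
  define b \<beta> \<sigma> where "b = B *v s" and "\<beta> = s \<bullet> b" and "\<sigma> = s \<bullet> y"
  have "s \<noteq> 0" using sy by auto
  then have \<beta>: "\<beta> > 0" using spd_pos[OF B] by (simp add: b_def \<beta>_def)
  have \<sigma>: "\<sigma> > 0" using sy by (simp add: \<sigma>_def)
  have sB: "s \<bullet> (B *v v) = b \<bullet> v" for v
    using spd_inner[OF B] by (simp add: b_def)
  define r where "r = sqrt (\<sigma> * \<beta>)"
  have r: "r * r = \<sigma> * \<beta>" "r > 0" using \<beta> \<sigma> by (auto simp: r_def)
  have w: "w = (1 / r) *\<^sub>R y - (1 / \<beta>) *\<^sub>R b"
    by (simp add: w_def b_def \<beta>_def \<sigma>_def r_def)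
  have "bfgs_update B s y *v v = ((mat 1 + outer w s) ** B ** (mat 1 + outer s w)) *v v" for v
  proof -
    \<comment> \<open>Expressing y through w turns the update into the expansion of the congruence.\<close>
    have y: "y = r *\<^sub>R (w + (1 / \<beta>) *\<^sub>R b)" using r by (simp add: w algebra_simps)
    have "bfgs_update B s y *v v = B *v v - ((b \<bullet> v) / \<beta>) *\<^sub>R b
        + (r * r / \<sigma> * ((w \<bullet> v) + (b \<bullet> v) / \<beta>)) *\<^sub>R (w + (1 / \<beta>) *\<^sub>R b)"
      using B by (simp add: bfgs_update_vec spd_def b_def[symmetric] \<beta>_def[symmetric]
          \<sigma>_def[symmetric]) (subst (1 2) y, simp add: inner_add_left algebra_simps)
    also have "r * r / \<sigma> = \<beta>" using r \<sigma> by simp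
    also have "B *v v - ((b \<bullet> v) / \<beta>) *\<^sub>R b + (\<beta> * ((w \<bullet> v) + (b \<bullet> v) / \<beta>)) *\<^sub>R (w + (1 / \<beta>) *\<^sub>R b)
        = B *v v + (w \<bullet> v) *\<^sub>R b + (b \<bullet> v + (w \<bullet> v) * \<beta>) *\<^sub>R w"
      using \<beta> by (simp add: algebra_simps)
    also have "\<dots> = ((mat 1 + outer w s) ** B ** (mat 1 + outer s w)) *v v"
      by (simp add: matrix_vector_mul_assoc[symmetric] matrix_vector_mult_add_rdistrib outer_vec
          matrix_vector_right_distrib matrix_vector_mult_scaleR b_def[symmetric] inner_add_right sB
          \<beta>_def algebra_simps)
    finally show ?thesis .
  qed
  then show ?thesis by (simp add: matrix_eq)
qed

lemma det_bfgs_update: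
  assumes B: "spd B" and sy: "0 < s \<bullet> y"
  shows "det (bfgs_update B s y) = det B * ((s \<bullet> y) / (s \<bullet> (B *v s)))"
proof -
  define \<beta> \<sigma> where "\<beta> = s \<bullet> (B *v s)" and "\<sigma> = s \<bullet> y"
  have "s \<noteq> 0" using sy by auto
  then have \<beta>: "\<beta> > 0" using spd_pos[OF B] by (simp add: \<beta>_def)
  have \<sigma>: "\<sigma> > 0" using sy by (simp add: \<sigma>_def)
  define w where "w = (1 / sqrt (\<sigma> * \<beta>)) *\<^sub>R y - (1 / \<beta>) *\<^sub>R (B *v s)"
  have ws: "1 + w \<bullet> s = \<sigma> / sqrt (\<sigma> * \<beta>)"
    using \<beta> by (simp add: w_def inner_diff_right \<sigma>_def inner_commute[of _ s] \<beta>_def[symmetric])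
  have "det (bfgs_update B s y) = (1 + w \<bullet> s) * det B * (1 + s \<bullet> w)"
    using bfgs_update_product_form[OF assms]
    by (simp add: det_mul det_mat_plus_outer w_def \<beta>_def \<sigma>_def)
  also have "\<dots> = det B * (\<sigma> / sqrt (\<sigma> * \<beta>))\<^sup>2"
    by (simp add: ws[symmetric] power2_eq_square inner_commute)
  also have "(\<sigma> / sqrt (\<sigma> * \<beta>))\<^sup>2 = \<sigma> / \<beta>"
    using \<sigma> \<beta> by (simp add: power_divide power2_eq_square)
  finally show ?thesis by (simp add: \<beta>_def \<sigma>_def)
qed

lemma spd_bfgs_update:
  assumes B: "spd B" and sy: "0 < s \<bullet> y"
  shows "spd (bfgs_update B s y)"
proof -
  have s0: "s \<noteq> 0" using sy by auto
  have B': "transpose B = B" using B by (simp add: spd_def)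
  define A where "A = bfgs_update B s y"
  have "transpose A = A"
  proof -
    have "transpose (outer v v) = outer v v" for v :: "real ^ 'a"
      by (simp add: transpose_def outer_def vec_eq_iff)
    then show ?thesis
      unfolding A_def bfgs_update_eq[OF B']
      using B' by (simp add: transpose_def outer_def vec_eq_iff mult.commute)
  qed
  moreover have "0 < v \<bullet> (A *v v)" if "v \<noteq> 0" for v
  proof -
    obtain w where w: "A = (mat 1 + outer w s) ** B ** (mat 1 + outer s w)"
      using bfgs_update_product_form[OF assms] A_def by blast
    define u where "u = v + (w \<bullet> v) *\<^sub>R s"
    have "det A \<noteq> 0"
      using det_bfgs_update[OF assms] sy spd_det_nonzero[OF B] spd_pos[OF B s0]
      by (simp add: A_def)
    then have "A *v v \<noteq> 0"
      using that by (metis invertible_det_nz matrix_left_invertible_ker invertible_left_inverse)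
    moreover have "A *v v = (mat 1 + outer w s) *v (B *v u)"
      by (simp add: w matrix_vector_mul_assoc[symmetric] matrix_vector_mult_add_rdistrib outer_vec u_def)
    ultimately have "u \<noteq> 0" by auto
    moreover have "v \<bullet> (A *v v) = u \<bullet> (B *v u)"
      by (simp add: \<open>A *v v = _\<close> matrix_vector_mult_add_rdistrib outer_vec u_def inner_add_left
          inner_commute algebra_simps)
    ultimately show ?thesis using spd_pos[OF B] by simp
  qed
  ultimately show ?thesis by (simp add: spd_def A_def)
qed

section \<open>The trace-determinant potential\<close>

text \<open>
  The absolute value makes the logarithm additive under updates as soon as the determinant is nonzero.
\<close>

definition potential :: "real ^ 'n ^ 'n \<Rightarrow> real ^ 'n ^ 'n \<Rightarrow> real" where
  "potential W B = trace (W ** B) - ln \<bar>det B\<bar>"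

text \<open>
  When \<open>B s\<close> is a negative multiple of the gradient, \<open>alignment\<close> is the squared cosine of the angle between
  the step and the negative gradient, divided by the curvature \<open>s \<bullet> y\<close> relative to the squared length of
  \<open>s\<close>, where lengths and angles refer to the coordinates in which \<open>W\<close> becomes the identity. The length
  of \<open>s\<close> cancels, and so does any scalar factor of \<open>B\<close>.
\<close>

definition alignment :: "real ^ 'n ^ 'n \<Rightarrow> real ^ 'n ^ 'n \<Rightarrow> real ^ 'n \<Rightarrow> real ^ 'n \<Rightarrow> real" where
  "alignment W B s y = (s \<bullet> (B *v s))\<^sup>2 / (((B *v s) \<bullet> (W *v (B *v s))) * (s \<bullet> y))"

text \<open>
  Trace and determinant change by explicit terms. The only loss is the inequality \<open>ln t \<le> t - 1\<close> for
  \<open>t = (B s \<bullet> W B s) / (s \<bullet> B s)\<close>, which trades the decrease of the trace for a logarithm.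
\<close>

lemma potential_bfgs_update:
  fixes W B :: "real ^ 'n ^ 'n"
  assumes B: "spd B" and W: "spd W" and sy: "0 < s \<bullet> y"
  shows "potential W (bfgs_update B s y)
    \<le> potential W B + y \<bullet> (W *v y) / (s \<bullet> y) - 1 + ln (alignment W B s y)"
proof -
  define b \<beta> \<sigma> \<tau> where "b = B *v s" and "\<beta> = s \<bullet> b" and "\<sigma> = s \<bullet> y" and "\<tau> = b \<bullet> (W *v b)"
  have "s \<noteq> 0" using sy by auto
  then have \<beta>: "\<beta> > 0" using spd_pos[OF B] by (simp add: b_def \<beta>_def)
  then have "b \<noteq> 0" by (auto simp: \<beta>_def)
  then have \<tau>: "\<tau> > 0" using spd_pos[OF W] by (simp add: \<tau>_def)
  have \<sigma>: "\<sigma> > 0" using sy by (simp add: \<sigma>_def)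
  have tr: "trace (W ** bfgs_update B s y) = trace (W ** B) - \<tau> / \<beta> + y \<bullet> (W *v y) / \<sigma>"
  proof -
    have "trace (W ** (c *\<^sub>R A)) = c * trace (W ** A)" for c and A :: "real ^ 'n ^ 'n"
      by (simp add: trace_def matrix_matrix_mult_def sum_distrib_left mult_ac)
    moreover have "trace (W ** (A - C)) = trace (W ** A) - trace (W ** C)" for A C :: "real ^ 'n ^ 'n"
      by (simp add: trace_def matrix_matrix_mult_def right_diff_distrib sum_subtractf)
    ultimately show ?thesis
      using B by (simp add: bfgs_update_eq spd_def matrix_add_ldistrib trace_add
          trace_mult_outer b_def \<beta>_def \<sigma>_def \<tau>_def)
  qed
  have "\<bar>det (bfgs_update B s y)\<bar> = \<bar>det B\<bar> * (\<sigma> / \<beta>)"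
    using \<sigma> \<beta> by (simp add: det_bfgs_update[OF B sy] abs_mult \<sigma>_def[symmetric]
        \<beta>_def[symmetric] b_def[symmetric])
  then have "ln \<bar>det (bfgs_update B s y)\<bar> = ln \<bar>det B\<bar> + ln (\<sigma> / \<beta>)"
    using \<sigma> \<beta> spd_det_nonzero[OF B] by (simp only:) (intro ln_mult_pos, auto)
  moreover have "ln (alignment W B s y) = - ln (\<sigma> / \<beta>) - ln (\<tau> / \<beta>)"
    using \<sigma> \<beta> \<tau> by (simp add: alignment_def \<sigma>_def[symmetric] \<beta>_def[symmetric]
        b_def[symmetric] \<tau>_def[symmetric] ln_div ln_mult power2_eq_square)
  moreover have "ln (\<tau> / \<beta>) \<le> \<tau> / \<beta> - 1" using \<tau> \<beta> by (intro ln_le_minus_one) simp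
  ultimately show ?thesis using tr by (simp add: potential_def \<sigma>_def)
qed

lemma spd_left_inverse:
  fixes W H :: "real ^ 'n ^ 'n"
  assumes H: "spd H" and WH: "W ** H = mat 1"
  shows "spd W"
proof -
  have HW: "H ** W = mat 1" using WH matrix_left_right_inverse by blast
  have "transpose W ** H = mat 1"
    using H HW by (metis matrix_transpose_mul spd_def transpose_mat)
  then have "transpose W = W" by (metis HW matrix_mul_assoc matrix_mul_lid matrix_mul_rid)
  moreover have "0 < v \<bullet> (W *v v)" if "v \<noteq> 0" for v
  proof -
    have v: "H *v (W *v v) = v" by (simp add: matrix_vector_mul_assoc HW)
    then have "W *v v \<noteq> 0" using that by auto
    then have "0 < (W *v v) \<bullet> (H *v (W *v v))" using spd_pos[OF H] by blast
    then show ?thesis using v by (simp add: inner_commute)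
  qed
  ultimately show ?thesis by (simp add: spd_def)
qed

text \<open>
  The BFGS update itself provides the proof. Updating \<open>B\<close> with the exact curvature pair \<open>(s, H s)\<close> does not
  increase the potential, by the Cauchy-Schwarz inequality. If \<open>s\<close> is \<open>H\<close>-conjugate to the subspace on
  which \<open>B\<close> and \<open>H\<close> already agree, the agreement on it is kept and extended by \<open>s\<close>. After finitely many
  such updates \<open>B\<close> has become \<open>H\<close>, whose potential is the claimed lower bound.
\<close>

lemma potential_minimal:
  fixes W H B :: "real ^ 'n ^ 'n"
  assumes H: "spd H" and WH: "W ** H = mat 1" and "spd B"
  shows "real CARD('n) - ln \<bar>det H\<bar> \<le> potential W B"
  using \<open>spd B\<close>
proof (induction "CARD('n) - dim {v. B *v v = H *v v}" arbitrary: B rule: less_induct)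
  case less
  note B = less.prems
  define V where "V = {v. B *v v = H *v v}"
  have subV: "subspace V"
    by (auto simp: V_def subspace_def matrix_vector_right_distrib matrix_vector_mult_scaleR)
  have W: "spd W" by (rule spd_left_inverse[OF H WH])
  show ?case
  proof (cases "V = UNIV")
    case True
    then have "B = H" by (auto simp: V_def matrix_eq)
    then show ?thesis by (simp add: potential_def WH trace_I)
  next
    case False
    have "dim V < CARD('n)"
      using False subV by (metis dim_eq_full dim_subset_UNIV_cart dim_vec_eq le_neq_implies_less
          span_eq_iff DIM_cart DIM_real mult_1_right)
    then have "dim ((*v) H ` V) < DIM(real ^ 'n)"
      using dim_image_le[of "(*v) H" V] by simp
    then obtain s where s0: "s \<noteq> 0" and s: "\<And>y. y \<in> span ((*v) H ` V) \<Longrightarrow> orthogonal s y"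
      using orthogonal_to_subspace_exists by blast
    have sV: "s \<bullet> (H *v v) = 0" if "v \<in> V" for v
      using s[of "H *v v"] that by (auto simp: orthogonal_def span_base)
    define y where "y = H *v s"
    have sy: "0 < s \<bullet> y" using spd_pos[OF H s0] by (simp add: y_def)
    define A where "A = bfgs_update B s y"
    have A: "spd A" using spd_bfgs_update[OF B sy] by (simp add: A_def)
    define V' where "V' = {v. A *v v = H *v v}"
    have subV': "subspace V'"
      by (auto simp: V'_def subspace_def matrix_vector_right_distrib matrix_vector_mult_scaleR)
    have "s \<in> V'" using bfgs_update_secant[OF B sy] by (simp add: V'_def A_def y_def)
    moreover have "s \<notin> V" using sV[of s] sy by (auto simp: y_def)
    moreover have "V \<subseteq> V'"
    proof
      fix v assume v: "v \<in> V"
      have "(B *v s) \<bullet> v = 0"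
        using sV[OF v] v spd_inner[OF B, of s v] by (simp add: V_def)
      moreover have "y \<bullet> v = 0"
        using sV[OF v] spd_inner[OF H, of s v] by (simp add: y_def)
      ultimately show "v \<in> V'"
        using v B by (simp add: V'_def V_def A_def bfgs_update_vec spd_def)
    qed
    ultimately have "V \<subset> V'" by blast
    then have "dim V < dim V'"
      using dim_psubset[of V V'] subV subV' by (metis span_eq_iff)
    moreover have "dim V' \<le> CARD('n)" using dim_subset_UNIV[of V'] by simp
    ultimately have "real CARD('n) - ln \<bar>det H\<bar> \<le> potential W A"
      using less.hyps[OF _ A] by (simp add: V_def V'_def)
    also have "\<dots> \<le> potential W B + y \<bullet> (W *v y) / (s \<bullet> y) - 1 + ln (alignment W B s y)"
      unfolding A_def by (rule potential_bfgs_update[OF B W sy])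
    finally have *: "real CARD('n) - ln \<bar>det H\<bar>
      \<le> potential W B + y \<bullet> (W *v y) / (s \<bullet> y) - 1 + ln (alignment W B s y)" .
    have "W *v y = s" by (simp add: y_def matrix_vector_mul_assoc WH)
    moreover have "ln (alignment W B s y) \<le> 0"
    proof -
      have b0: "B *v s \<noteq> 0" using spd_pos[OF B s0] by auto
      have "(s \<bullet> (B *v s))\<^sup>2 = ((B *v s) \<bullet> (W *v y))\<^sup>2"
        by (simp add: \<open>W *v y = s\<close> inner_commute)
      also have "\<dots> \<le> ((B *v s) \<bullet> (W *v (B *v s))) * (y \<bullet> (W *v y))"
        by (rule spd_cauchy_schwarz[OF W])
      finally have "alignment W B s y \<le> 1"
        using spd_pos[OF W b0] sy
        by (simp add: alignment_def \<open>W *v y = s\<close> inner_commute)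
      moreover have "0 < alignment W B s y"
        using spd_pos[OF W b0] sy spd_pos[OF B s0] by (simp add: alignment_def)
      ultimately show ?thesis by simp
    qed
    ultimately show ?thesis using * sy by (simp add: inner_commute)
  qed
qed


section \<open>Second-order calculus along lines\<close>

text \<open>
  Global inequalities for \<open>f\<close> and its gradient are turned into pointwise ones for the gradient and the
  Hessian by one-sided difference quotients; \<open>b\<close> absorbs terms of higher order.
\<close>

lemma derivative_at_0_le:
  fixes \<phi> :: "real \<Rightarrow> real"
  assumes der: "(\<phi> has_real_derivative D) (at 0)"
    and le: "\<And>t. 0 < t \<Longrightarrow> t < 1 \<Longrightarrow> \<phi> t - \<phi> 0 \<le> t * (a + b * t)"
  shows "D \<le> a"
proof (rule tendsto_le)
  show "((\<lambda>t. (\<phi> t - \<phi> 0) / t) \<longlongrightarrow> D) (at_right 0)"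
    using der by (auto simp: has_field_derivative_iff intro: filterlim_mono at_le)
  show "((\<lambda>t. a + b * t) \<longlongrightarrow> a) (at_right 0)"
    by (auto intro!: tendsto_eq_intros)
  show "\<forall>\<^sub>F t in at_right 0. (\<phi> t - \<phi> 0) / t \<le> a + b * t"
    unfolding eventually_at_right_field
    by (rule exI[of _ 1]) (use le in \<open>auto simp: divide_le_eq mult.commute\<close>)
qed simp

lemma line_derivative:
  assumes "twice_cont_diff f"
  shows "((\<lambda>t. f (x + t *\<^sub>R v)) has_real_derivative v \<bullet> grad f (x + t *\<^sub>R v)) (at t)"
proof -
  have "(f has_derivative (\<lambda>h. h \<bullet> grad f (x + t *\<^sub>R v))) (at (x + t *\<^sub>R v))"
    using assms GDERIV_grad unfolding twice_cont_diff_def gderiv_def by blast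
  then have "((\<lambda>t. f (x + t *\<^sub>R v)) has_derivative (\<lambda>h. (h *\<^sub>R v) \<bullet> grad f (x + t *\<^sub>R v))) (at t)"
    by (rule has_derivative_compose[rotated]) (auto intro!: derivative_eq_intros)
  then show ?thesis by (simp add: has_field_derivative_def mult.commute[of _ "v \<bullet> _"])
qed

lemma grad_line_derivative:
  assumes "twice_cont_diff f"
  shows "((\<lambda>t. u \<bullet> grad f (x + t *\<^sub>R v)) has_real_derivative u \<bullet> (hess f (x + t *\<^sub>R v) *v v)) (at t)"
proof -
  have "(grad f has_derivative (\<lambda>h. hess f (x + t *\<^sub>R v) *v h)) (at (x + t *\<^sub>R v))"
    using assms has_derivative_hess unfolding twice_cont_diff_def by blast
  then have "((\<lambda>t. grad f (x + t *\<^sub>R v)) has_derivative (\<lambda>h. hess f (x + t *\<^sub>R v) *v (h *\<^sub>R v))) (at t)"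
    by (rule has_derivative_compose[rotated]) (auto intro!: derivative_eq_intros)
  then have "((\<lambda>t. u \<bullet> grad f (x + t *\<^sub>R v)) has_derivative
      (\<lambda>h. u \<bullet> (hess f (x + t *\<^sub>R v) *v (h *\<^sub>R v)))) (at t)"
    by (rule bounded_linear.has_derivative[OF bounded_linear_inner_right])
  then show ?thesis
    by (simp add: has_field_derivative_def matrix_vector_mult_scaleR mult.commute[of _ "u \<bullet> _"])
qed

text \<open>
  A mean value theorem for the gradient holds only after pairing it with a fixed vector \<open>u\<close>; this form
  is what replaces the averaged Hessian along the segment in the estimates below.
\<close>

lemma grad_mean_value:
  assumes "twice_cont_diff f"
  obtains t where "0 < t" "t < 1"
    "u \<bullet> (grad f (x + v) - grad f x) = u \<bullet> (hess f (x + t *\<^sub>R v) *v v)"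
proof -
  have "\<exists>t>0. t < 1 \<and> u \<bullet> grad f (x + 1 *\<^sub>R v) - u \<bullet> grad f (x + 0 *\<^sub>R v)
      = (1 - 0) * (u \<bullet> (hess f (x + t *\<^sub>R v) *v v))"
    by (rule MVT2) (use grad_line_derivative[OF assms] in auto)
  then show thesis using that by (auto simp: inner_diff_right)
qed

lemma taylor_second_order:
  assumes "twice_cont_diff f"
  obtains t where "0 < t" "t < 1"
    "f (x + v) = f x + v \<bullet> grad f x + v \<bullet> (hess f (x + t *\<^sub>R v) *v v) / 2"
proof -
  define D where "D m t = (if m = 0 then f (x + t *\<^sub>R v) else if m = 1 then v \<bullet> grad f (x + t *\<^sub>R v)
    else v \<bullet> (hess f (x + t *\<^sub>R v) *v v))" for m :: nat and t
  have "\<exists>t>0. t < 1 \<and> D 0 1 = (\<Sum>m<2. D m 0 / fact m * 1 ^ m) + D 2 t / fact 2 * 1 ^ 2"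
  proof (rule Maclaurin)
    show "\<forall>m t. m < 2 \<and> 0 \<le> t \<and> t \<le> 1 \<longrightarrow> DERIV (D m) t :> D (Suc m) t"
    proof (intro allI impI)
      fix m :: nat and t :: real assume "m < 2 \<and> 0 \<le> t \<and> t \<le> 1"
      then consider "m = 0" | "m = 1" by linarith
      then show "DERIV (D m) t :> D (Suc m) t"
        using line_derivative[OF assms, of x v t] grad_line_derivative[OF assms, of v x v t]
        by cases (simp_all add: D_def[abs_def])
    qed
  qed auto
  then show thesis using that by (auto simp: D_def numeral_2_eq_2)
qed

text \<open>
  The left side is symmetric in \<open>u\<close> and \<open>v\<close>; comparing the two resulting expressions at small scales shows
  that the Hessian is symmetric.
\<close>

lemma second_difference:
  assumes "twice_cont_diff f"
  obtains a b where "0 < a" "a < 1" "0 < b" "b < 1"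
    "f (x + u + v) - f (x + u) - f (x + v) + f x = u \<bullet> (hess f (x + a *\<^sub>R u + b *\<^sub>R v) *v v)"
proof -
  have der: "((\<lambda>t. f (x + v + t *\<^sub>R u) - f (x + t *\<^sub>R u)) has_real_derivative
      u \<bullet> grad f (x + v + t *\<^sub>R u) - u \<bullet> grad f (x + t *\<^sub>R u)) (at t)" for t
    by (intro DERIV_diff line_derivative[OF assms])
  have "\<exists>a>0. a < 1 \<and> (f (x + v + 1 *\<^sub>R u) - f (x + 1 *\<^sub>R u)) - (f (x + v + 0 *\<^sub>R u) - f (x + 0 *\<^sub>R u))
      = (1 - 0) * (u \<bullet> grad f (x + v + a *\<^sub>R u) - u \<bullet> grad f (x + a *\<^sub>R u))"
    by (rule MVT2) (use der in auto)
  then obtain a where a: "0 < a" "a < 1"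
    and eq: "f (x + v + u) - f (x + u) - f (x + v) + f x
      = u \<bullet> (grad f (x + v + a *\<^sub>R u) - grad f (x + a *\<^sub>R u))"
    by (auto simp: inner_diff_right)
  obtain b where b: "0 < b" "b < 1"
    and eq2: "u \<bullet> (grad f ((x + a *\<^sub>R u) + v) - grad f (x + a *\<^sub>R u))
      = u \<bullet> (hess f (x + a *\<^sub>R u + b *\<^sub>R v) *v v)"
    using grad_mean_value[OF assms] by blast
  show thesis
    by (rule that[OF a b]) (use eq eq2 in \<open>simp add: add_ac\<close>)
qed

lemma hess_symmetric:
  assumes f: "twice_cont_diff f"
  shows "transpose (hess f x) = hess f x"
proof -
  have sym: "u \<bullet> (hess f x *v v) = v \<bullet> (hess f x *v u)" for u v
  proof -
    \<comment> \<open>Scale both directions by h n and let n tend to infinity: the intermediate points converge to x.\<close>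
    define h where "h n = 1 / real (Suc n)" for n
    have h: "h \<longlonglongrightarrow> 0" unfolding h_def by (rule LIMSEQ_Suc[OF lim_1_over_n])
    have lim: "(\<lambda>n. p \<bullet> (hess f (x + (a n * h n) *\<^sub>R u + (b n * h n) *\<^sub>R v) *v q))
        \<longlonglongrightarrow> p \<bullet> (hess f x *v q)"
      if ab: "\<And>n. 0 < a n \<and> a n < 1 \<and> 0 < b n \<and> b n < 1" for a b :: "nat \<Rightarrow> real" and p q
    proof -
      have to_0: "(\<lambda>n. c n * h n) \<longlonglongrightarrow> 0" if "\<And>n. 0 < c n \<and> c n < 1" for c :: "nat \<Rightarrow> real"
        by (rule Lim_null_comparison[OF _ h])
           (use that in \<open>auto simp: h_def abs_mult less_imp_le intro!: always_eventually mult_left_le_one_le divide_right_mono\<close>)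
      have "(\<lambda>n. x + (a n * h n) *\<^sub>R u + (b n * h n) *\<^sub>R v) \<longlonglongrightarrow> x + 0 *\<^sub>R u + 0 *\<^sub>R v"
        by (intro tendsto_intros to_0) (use ab in auto)
      then have z: "(\<lambda>n. x + (a n * h n) *\<^sub>R u + (b n * h n) *\<^sub>R v) \<longlonglongrightarrow> x" by simp
      have "isCont (hess f) x"
        using f by (simp add: twice_cont_diff_def continuous_on_eq_continuous_at)
      then have "(\<lambda>n. hess f (x + (a n * h n) *\<^sub>R u + (b n * h n) *\<^sub>R v)) \<longlonglongrightarrow> hess f x"
        using z by (rule isCont_tendsto_compose)
      then show ?thesis
        unfolding matrix_vector_mult_def inner_vec_def by (simp, intro tendsto_intros) auto
    qed
    have "\<exists>a b. 0 < a \<and> a < 1 \<and> 0 < b \<and> b < 1 \<and>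
      f (x + h n *\<^sub>R u + h n *\<^sub>R v) - f (x + h n *\<^sub>R u) - f (x + h n *\<^sub>R v) + f x
        = h n * h n * (u \<bullet> (hess f (x + (a * h n) *\<^sub>R u + (b * h n) *\<^sub>R v) *v v))" for n
      by (rule second_difference[OF f, of x "h n *\<^sub>R u" "h n *\<^sub>R v"])
         (auto simp: matrix_vector_mult_scaleR)
    then obtain a b where ab: "\<And>n. 0 < a n \<and> a n < 1 \<and> 0 < b n \<and> b n < 1" and
      eq: "\<And>n. f (x + h n *\<^sub>R u + h n *\<^sub>R v) - f (x + h n *\<^sub>R u) - f (x + h n *\<^sub>R v) + f x
        = h n * h n * (u \<bullet> (hess f (x + (a n * h n) *\<^sub>R u + (b n * h n) *\<^sub>R v) *v v))"
      by metis
    have "\<exists>a b. 0 < a \<and> a < 1 \<and> 0 < b \<and> b < 1 \<and>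
      f (x + h n *\<^sub>R u + h n *\<^sub>R v) - f (x + h n *\<^sub>R u) - f (x + h n *\<^sub>R v) + f x
        = h n * h n * (v \<bullet> (hess f (x + (a * h n) *\<^sub>R u + (b * h n) *\<^sub>R v) *v u))" for n
    proof -
      obtain a b where "0 < a" "a < 1" "0 < b" "b < 1"
        "f (x + h n *\<^sub>R v + h n *\<^sub>R u) - f (x + h n *\<^sub>R v) - f (x + h n *\<^sub>R u) + f x
          = (h n *\<^sub>R v) \<bullet> (hess f (x + a *\<^sub>R (h n *\<^sub>R v) + b *\<^sub>R (h n *\<^sub>R u)) *v (h n *\<^sub>R u))"
        using second_difference[OF f] by blast
      then show ?thesis
        by (intro exI[of _ b] exI[of _ a]) (auto simp: matrix_vector_mult_scaleR add_ac)
    qed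
    then obtain a' b' where ab': "\<And>n. 0 < a' n \<and> a' n < 1 \<and> 0 < b' n \<and> b' n < 1" and
      eq': "\<And>n. f (x + h n *\<^sub>R u + h n *\<^sub>R v) - f (x + h n *\<^sub>R u) - f (x + h n *\<^sub>R v) + f x
        = h n * h n * (v \<bullet> (hess f (x + (a' n * h n) *\<^sub>R u + (b' n * h n) *\<^sub>R v) *v u))"
      by metis
    have "h n * h n \<noteq> 0" for n by (simp add: h_def)
    \<comment> \<open>Both sides are the same second difference, divided by the square of h n.\<close>
    then have same: "u \<bullet> (hess f (x + (a n * h n) *\<^sub>R u + (b n * h n) *\<^sub>R v) *v v)
      = v \<bullet> (hess f (x + (a' n * h n) *\<^sub>R u + (b' n * h n) *\<^sub>R v) *v u)" for n
      using eq[of n] eq'[of n] by simp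
    show ?thesis
      using lim[where a = a and b = b and p = u and q = v, OF ab]
        lim[where a = a' and b = b' and p = v and q = u, OF ab']
      unfolding same by (rule LIMSEQ_unique)
  qed
  have "hess f x $ i $ j = hess f x $ j $ i" for i j
    using sym[of "axis i 1" "axis j 1"]
    by (simp add: matrix_vector_mul_component inner_axis' inner_axis)
  then show ?thesis by (simp add: transpose_def vec_eq_iff)
qed

section \<open>Strongly convex functions with Lipschitz gradient\<close>

locale smooth_strongly_convex =
  fixes f :: "real ^ 'n \<Rightarrow> real" and \<mu> L :: real
  assumes smooth: "twice_cont_diff f"
    and \<mu>_pos: "\<mu> > 0"
    and convex: "strongly_convex \<mu> f"
    and lipschitz: "\<And>y z. norm (grad f y - grad f z) \<le> L * norm (y - z)"
begin

lemma ge_quadratic: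
  "f y \<ge> f x + (y - x) \<bullet> grad f x + \<mu> / 2 * (norm (y - x))\<^sup>2"
proof -
  define N where "N = (norm (y - x))\<^sup>2"
  have "(y - x) \<bullet> grad f (x + 0 *\<^sub>R (y - x)) \<le> f y - f x - \<mu> / 2 * N"
  proof (rule derivative_at_0_le[OF line_derivative[OF smooth]])
    fix t :: real assume t: "0 < t" "t < 1"
    have "f (t *\<^sub>R y + (1 - t) *\<^sub>R x) \<le> t * f y + (1 - t) * f x - \<mu> / 2 * t * (1 - t) * N"
      using convex t by (simp add: strongly_convex_def N_def)
    moreover have "t *\<^sub>R y + (1 - t) *\<^sub>R x = x + t *\<^sub>R (y - x)" by (simp add: algebra_simps)
    ultimately show "f (x + t *\<^sub>R (y - x)) - f (x + 0 *\<^sub>R (y - x))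
        \<le> t * ((f y - f x - \<mu> / 2 * N) + (\<mu> / 2 * N) * t)"
      by (simp add: algebra_simps diff_divide_distrib)
  qed
  then show ?thesis by (simp add: N_def)
qed

lemma grad_strongly_monotone:
  "\<mu> * (norm (y - x))\<^sup>2 \<le> (y - x) \<bullet> (grad f y - grad f x)"
  using ge_quadratic[of x y] ge_quadratic[of y x]
  by (simp add: norm_minus_commute inner_diff_left inner_diff_right)

lemma hess_ge: "\<mu> * (v \<bullet> v) \<le> v \<bullet> (hess f x *v v)"
proof -
  have "- (v \<bullet> (hess f (x + 0 *\<^sub>R v) *v v)) \<le> - (\<mu> * (v \<bullet> v))"
  proof (rule derivative_at_0_le)
    show "((\<lambda>t. - (v \<bullet> grad f (x + t *\<^sub>R v))) has_real_derivative
        - (v \<bullet> (hess f (x + 0 *\<^sub>R v) *v v))) (at 0)"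
      by (intro DERIV_minus grad_line_derivative[OF smooth])
    fix t :: real assume t: "0 < t" "t < 1"
    have "t * (t * (\<mu> * (v \<bullet> v))) \<le> t * (v \<bullet> (grad f (x + t *\<^sub>R v) - grad f x))"
      using grad_strongly_monotone[of "x + t *\<^sub>R v" x]
      unfolding power2_norm_eq_inner by (simp add: mult_ac)
    then have "t * (\<mu> * (v \<bullet> v)) \<le> v \<bullet> (grad f (x + t *\<^sub>R v) - grad f x)" using t by simp
    then show "- (v \<bullet> grad f (x + t *\<^sub>R v)) - - (v \<bullet> grad f (x + 0 *\<^sub>R v))
        \<le> t * (- (\<mu> * (v \<bullet> v)) + 0 * t)"
      by (simp add: inner_diff_right)
  qed
  then show ?thesis by simp
qed

lemma hess_le: "v \<bullet> (hess f x *v v) \<le> L * (v \<bullet> v)"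
proof -
  have "v \<bullet> (hess f (x + 0 *\<^sub>R v) *v v) \<le> L * (v \<bullet> v)"
  proof (rule derivative_at_0_le[OF grad_line_derivative[OF smooth]])
    fix t :: real assume t: "0 < t" "t < 1"
    have "v \<bullet> (grad f (x + t *\<^sub>R v) - grad f x) \<le> norm v * norm (grad f (x + t *\<^sub>R v) - grad f x)"
      by (rule norm_cauchy_schwarz)
    also have "\<dots> \<le> norm v * (L * norm (t *\<^sub>R v))"
      using lipschitz[of "x + t *\<^sub>R v" x] by (intro mult_left_mono) auto
    also have "\<dots> = t * (L * (v \<bullet> v))"
      using t by (simp add: power2_norm_eq_inner[symmetric] power2_eq_square)
    finally show "v \<bullet> grad f (x + t *\<^sub>R v) - v \<bullet> grad f (x + 0 *\<^sub>R v) \<le> t * (L * (v \<bullet> v) + 0 * t)"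
      by (simp add: inner_diff_right)
  qed
  then show ?thesis by simp
qed

lemma \<mu>_le_L: "\<mu> \<le> L"
proof -
  fix k :: 'n
  show ?thesis using hess_ge[of "axis k 1" 0] hess_le[of "axis k 1" 0]
    by (simp add: inner_axis)
qed

lemma L_pos: "L > 0" using \<mu>_pos \<mu>_le_L by simp

lemma segment_le:
  assumes "0 \<le> t" "t \<le> 1" "f (x + v) \<le> a" "f x \<le> a"
  shows "f (x + t *\<^sub>R v) \<le> a"
proof -
  have "f (t *\<^sub>R (x + v) + (1 - t) *\<^sub>R x)
      \<le> t * f (x + v) + (1 - t) * f x - \<mu> / 2 * t * (1 - t) * (norm (x + v - x))\<^sup>2"
    using convex assms(1,2) unfolding strongly_convex_def by blast
  also have "\<dots> \<le> t * a + (1 - t) * a"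
  proof -
    have "0 \<le> \<mu> / 2 * t * (1 - t) * (norm (x + v - x))\<^sup>2" using assms \<mu>_pos by simp
    moreover have "t * f (x + v) \<le> t * a" "(1 - t) * f x \<le> (1 - t) * a"
      using assms by (auto intro: mult_left_mono)
    ultimately show ?thesis by linarith
  qed
  finally show ?thesis by (simp add: algebra_simps)
qed

text \<open>
  If the Hessian quadratic form along the segment is at most \<open>K (v \<bullet> y)\<close> in direction \<open>v\<close>, expand the
  nonnegative Hessian form of \<open>v - K s\<close>. Taking \<open>v = y\<close> and \<open>K = L\<close> gives the usual cocoercivity of the
  gradient; \<open>v = W y\<close> gives its version in the metric of the Hessian at the minimizer.
\<close>

lemma grad_diff_cocoercive:
  fixes x s v :: "real ^ 'n"
  defines "y \<equiv> grad f (x + s) - grad f x"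
  assumes K: "K > 0"
    and v: "\<And>t. 0 < t \<Longrightarrow> t < 1 \<Longrightarrow> v \<bullet> (hess f (x + t *\<^sub>R s) *v v) \<le> K * (v \<bullet> y)"
  shows "v \<bullet> y \<le> K * (s \<bullet> y)"
proof -
  \<comment> \<open>The combination v - (K / 2) s makes the mixed and the pure s-terms appear in one mean value.\<close>
  obtain t where t: "0 < t" "t < 1" and eq:
    "(v - (K / 2) *\<^sub>R s) \<bullet> y = (v - (K / 2) *\<^sub>R s) \<bullet> (hess f (x + t *\<^sub>R s) *v s)"
    unfolding y_def using grad_mean_value[OF smooth] by blast
  define H where "H = hess f (x + t *\<^sub>R s)"
  have "(H *v u) \<bullet> w = u \<bullet> (H *v w)" for u w
    using hess_symmetric[OF smooth, of "x + t *\<^sub>R s"]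
    by (metis H_def dot_lmul_matrix transpose_matrix_vector)
  then have sym: "s \<bullet> (H *v v) = v \<bullet> (H *v s)" by (metis inner_commute)
  have "0 \<le> \<mu> * ((v - K *\<^sub>R s) \<bullet> (v - K *\<^sub>R s))" using \<mu>_pos by simp
  also have "\<dots> \<le> (v - K *\<^sub>R s) \<bullet> (H *v (v - K *\<^sub>R s))" unfolding H_def by (rule hess_ge)
  also have "\<dots> = v \<bullet> (H *v v) - 2 * K * ((v - (K / 2) *\<^sub>R s) \<bullet> (H *v s))"
    by (simp add: matrix_vector_mult_diff_distrib matrix_vector_mult_scaleR sym
        inner_diff_left inner_diff_right algebra_simps)
  also have "\<dots> \<le> K * (v \<bullet> y) - 2 * K * ((v - (K / 2) *\<^sub>R s) \<bullet> y)"
    using v[OF t] eq by (simp add: H_def)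
  also have "\<dots> = K * (K * (s \<bullet> y) - v \<bullet> y)" by (simp add: inner_diff_left algebra_simps)
  finally show ?thesis using K by (simp add: zero_le_mult_iff)
qed

lemma le_quadratic: "f (x + v) \<le> f x + v \<bullet> grad f x + L / 2 * (v \<bullet> v)"
proof -
  obtain t where "f (x + v) = f x + v \<bullet> grad f x + v \<bullet> (hess f (x + t *\<^sub>R v) *v v) / 2"
    using taylor_second_order[OF smooth] by blast
  then show ?thesis using hess_le[of v "x + t *\<^sub>R v"] by simp
qed

text \<open>
  Along the step the curvature of \<open>f\<close> lies between \<open>\<mu>\<close> and \<open>L\<close>. For a given slope at the start and slope
  zero at the end, the decrease is smallest when the curvature is \<open>L\<close> on an initial part of the segment
  and \<open>\<mu>\<close> afterwards; \<open>\<tau>\<close> is the length of the initial part in the worst case.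
\<close>

lemma decrease_ge_condition_number:
  assumes opt: "s \<bullet> grad f (x + s) = 0"
  shows "s \<bullet> (grad f (x + s) - grad f x) \<le> (1 + sqrt (L / \<mu>)) * (f x - f (x + s))"
proof -
  define r where "r = sqrt (L / \<mu>)"
  define \<tau> where "\<tau> = 1 / (1 + r)"
  have r: "r > 0" "r * r = L / \<mu>" using \<mu>_pos L_pos by (auto simp: r_def)
  have L: "L = \<mu> * (r * r)" using r \<mu>_pos by simp
  have \<tau>: "\<tau> > 0" "1 - \<tau> = r * \<tau>" using r by (auto simp: \<tau>_def field_simps)
  define D where "D = s \<bullet> (grad f (x + s) - grad f x)"
  have D: "s \<bullet> grad f x = - D" using opt by (simp add: D_def inner_diff_right)
  have "f (x + \<tau> *\<^sub>R s) \<le> f x - \<tau> * D + L / 2 * \<tau>\<^sup>2 * (s \<bullet> s)"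
    using le_quadratic[of x "\<tau> *\<^sub>R s"] D by (simp add: power2_eq_square mult_ac)
  moreover have "f (x + s) + \<mu> / 2 * (r * \<tau>)\<^sup>2 * (s \<bullet> s) \<le> f (x + \<tau> *\<^sub>R s)"
  proof -
    have "x + \<tau> *\<^sub>R s - (x + s) = - ((r * \<tau>) *\<^sub>R s)"
      unfolding \<tau>(2)[symmetric] by (simp add: algebra_simps)
    then show ?thesis
      using ge_quadratic[of "x + s" "x + \<tau> *\<^sub>R s"] opt
      by (simp add: power_mult_distrib power2_norm_eq_inner mult_ac)
  qed
  ultimately have "\<tau> * D \<le> f x - f (x + s)"
    by (simp add: L power2_eq_square mult_ac)
  then have "D \<le> (1 + r) * (f x - f (x + s))"
    using r(1) by (simp add: \<tau>_def field_simps)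
  then show ?thesis by (simp add: D_def r_def)
qed

end


section \<open>Exact line search steps and the Hessian at the minimizer\<close>

locale hessian_lipschitz_at_minimizer = smooth_strongly_convex f \<mu> L
  for f :: "real ^ 'n \<Rightarrow> real" and \<mu> L :: real +
  fixes xstar :: "real ^ 'n" and M :: real
  assumes minimizer: "\<And>z. f xstar \<le> f z"
    and M_pos: "M > 0"
    and hess_lipschitz: "\<And>z. spectral_norm (hess f z - hess f xstar) \<le> M * norm (z - xstar)"
begin

definition gap :: "real ^ 'n \<Rightarrow> real" where
  "gap z = f z - f xstar"

text \<open>
  By strong convexity, points where \<open>f\<close> is at most \<open>f z\<close> are so close to the minimizer that the Hessian
  there differs from the one at the minimizer by at most \<open>hess_dev z\<close> times \<open>\<mu>\<close>. Since \<open>\<mu> I\<close> is below both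
  Hessians, this is a relative error in either direction.
\<close>

definition hess_dev :: "real ^ 'n \<Rightarrow> real" where
  "hess_dev z = M / \<mu> powr (3 / 2) * sqrt (2 * gap z)"

lemma grad_minimizer: "grad f xstar = 0"
proof -
  define g where "g = grad f xstar"
  have "f xstar \<le> f (xstar + (- (1 / L)) *\<^sub>R g)" by (rule minimizer)
  also have "\<dots> \<le> f xstar - (g \<bullet> g) / L + L / 2 * ((g \<bullet> g) / L\<^sup>2)"
    using le_quadratic[of xstar "(- (1 / L)) *\<^sub>R g"]
    by (simp add: g_def[symmetric] power2_eq_square)
  also have "\<dots> = f xstar - (g \<bullet> g) / (2 * L)"
    using L_pos by (simp add: field_simps power2_eq_square)
  finally have "g \<bullet> g \<le> 0" using L_pos by (simp add: divide_le_0_iff)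
  then show ?thesis by (metis g_def inner_ge_zero inner_eq_zero_iff order_antisym)
qed

lemma gap_ge_dist: "\<mu> / 2 * (norm (z - xstar))\<^sup>2 \<le> gap z"
  using ge_quadratic[of xstar z] by (simp add: gap_def grad_minimizer)

lemma gap_nonneg: "0 \<le> gap z"
  using minimizer by (simp add: gap_def)

lemma gap_pos: "z \<noteq> xstar \<Longrightarrow> 0 < gap z"
proof -
  assume "z \<noteq> xstar"
  then have "0 < \<mu> / 2 * (norm (z - xstar))\<^sup>2" using \<mu>_pos by simp
  then show ?thesis using gap_ge_dist[of z] by linarith
qed

lemma grad_nonzero: "z \<noteq> xstar \<Longrightarrow> grad f z \<noteq> 0"
proof
  assume "z \<noteq> xstar" and "grad f z = 0"
  then have "0 < \<mu> * (norm (z - xstar))\<^sup>2" using \<mu>_pos by simp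
  also have "\<dots> \<le> 0"
    using grad_strongly_monotone[of z xstar] \<open>grad f z = 0\<close> by (simp add: grad_minimizer)
  finally show False by simp
qed

text \<open>
  The Polyak-Lojasiewicz inequality: minimize the quadratic lower bound over the other point.
\<close>

lemma gap_le_grad: "2 * \<mu> * gap z \<le> grad f z \<bullet> grad f z"
proof -
  define u g where "u = xstar - z" and "g = grad f z"
  have "0 \<le> (\<mu> *\<^sub>R u + g) \<bullet> (\<mu> *\<^sub>R u + g)" by simp
  also have "\<dots> = 2 * \<mu> * (u \<bullet> g + \<mu> / 2 * (u \<bullet> u)) + g \<bullet> g"
    by (simp add: inner_add_left inner_add_right inner_commute algebra_simps)
  also have "2 * \<mu> * (u \<bullet> g + \<mu> / 2 * (u \<bullet> u)) \<le> 2 * \<mu> * - gap z"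
    using ge_quadratic[of z xstar] \<mu>_pos
    by (intro mult_left_mono) (auto simp: u_def g_def gap_def power2_norm_eq_inner)
  finally show ?thesis by (simp add: g_def)
qed

lemma hess_dev_nonneg: "0 \<le> hess_dev z"
  using M_pos gap_nonneg[of z] by (simp add: hess_dev_def)

lemma hess_near:
  assumes "f z \<le> f x"
  shows "\<bar>v \<bullet> (hess f z *v v) - v \<bullet> (hess f xstar *v v)\<bar> \<le> hess_dev x * (\<mu> * (v \<bullet> v))"
proof -
  define A where "A = hess f z - hess f xstar"
  have "\<bar>v \<bullet> (hess f z *v v) - v \<bullet> (hess f xstar *v v)\<bar> = \<bar>v \<bullet> (A *v v)\<bar>"
    by (simp add: A_def matrix_vector_mult_diff_rdistrib inner_diff_right)
  also have "\<dots> \<le> norm v * norm (A *v v)" by (rule Cauchy_Schwarz_ineq2)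
  also have "\<dots> \<le> norm v * (spectral_norm A * norm v)"
    unfolding spectral_norm_def
    by (intro mult_left_mono onorm matrix_vector_mul_bounded_linear) auto
  also have "\<dots> = spectral_norm A * (v \<bullet> v)"
    by (simp add: power2_norm_eq_inner[symmetric] power2_eq_square)
  also have "\<dots> \<le> (M * norm (z - xstar)) * (v \<bullet> v)"
    using hess_lipschitz[of z] by (intro mult_right_mono) (auto simp: A_def)
  also have "\<dots> \<le> (hess_dev x * \<mu>) * (v \<bullet> v)"
  proof (rule mult_right_mono)
    have "(norm (z - xstar))\<^sup>2 \<le> 2 * gap x / \<mu>"
      using gap_ge_dist[of z] assms \<mu>_pos by (simp add: gap_def field_simps)
    then have "norm (z - xstar) \<le> sqrt (2 * gap x / \<mu>)" by (rule real_le_rsqrt)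
    then have "M * norm (z - xstar) \<le> M * (sqrt (2 * gap x) / sqrt \<mu>)"
      using M_pos by (intro mult_left_mono) (auto simp: real_sqrt_divide)
    also have "\<mu> powr (3 / 2) = \<mu> * sqrt \<mu>"
      using powr_add[of \<mu> 1 "1/2"] \<mu>_pos by (simp add: powr_half_sqrt)
    then have "M * (sqrt (2 * gap x) / sqrt \<mu>) = hess_dev x * \<mu>"
      using \<mu>_pos by (simp add: hess_dev_def)
    finally show "M * norm (z - xstar) \<le> hess_dev x * \<mu>" .
  qed simp
  finally show ?thesis by (simp add: mult_ac)
qed

lemma
  assumes "f z \<le> f x"
  shows hess_le_star: "v \<bullet> (hess f z *v v) \<le> (1 + hess_dev x) * (v \<bullet> (hess f xstar *v v))"
    and hess_star_le: "v \<bullet> (hess f xstar *v v) \<le> (1 + hess_dev x) * (v \<bullet> (hess f z *v v))"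
  using hess_near[OF assms, of v] mult_left_mono[OF hess_ge[of v z] hess_dev_nonneg[of x]]
    mult_left_mono[OF hess_ge[of v xstar] hess_dev_nonneg[of x]]
  unfolding distrib_right mult_1_left abs_le_iff by linarith+

lemma hess_le_hess:
  assumes "f z \<le> f x" "f w \<le> f x"
  shows "v \<bullet> (hess f z *v v) \<le> (1 + 2 * hess_dev x) * (v \<bullet> (hess f w *v v))"
  using hess_near[OF assms(1), of v] hess_near[OF assms(2), of v]
    mult_left_mono[OF hess_ge[of v w] hess_dev_nonneg[of x]]
  unfolding distrib_right mult_1_left abs_le_iff mult.assoc by linarith

lemma spd_hess: "spd (hess f z)"
  unfolding spd_def
proof (intro conjI allI impI)
  show "transpose (hess f z) = hess f z" by (rule hess_symmetric[OF smooth])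
  fix v :: "real ^ 'n" assume "v \<noteq> 0"
  then have "0 < \<mu> * (v \<bullet> v)" using \<mu>_pos by simp
  also have "\<dots> \<le> v \<bullet> (hess f z *v v)" by (rule hess_ge)
  finally show "0 < v \<bullet> (hess f z *v v)" .
qed

text \<open>
  All that the convergence proof uses about an iteration: \<open>s\<close> is a positive multiple of the quasi-Newton
  direction and ends at a stationary point of the line. The clause \<open>0 < s \<bullet> y\<close>, with \<open>y\<close> the change of the
  gradient, is what keeps the updated \<open>B\<close> positive definite.
\<close>

definition exact_step :: "real ^ 'n ^ 'n \<Rightarrow> real ^ 'n \<Rightarrow> real ^ 'n \<Rightarrow> bool" where
  "exact_step B x s \<longleftrightarrow> s \<bullet> grad f (x + s) = 0 \<and> 0 < s \<bullet> (grad f (x + s) - grad f x) \<and>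
     f (x + s) \<le> f x \<and> (\<exists>\<eta>>0. B *v s = - (\<eta> *\<^sub>R grad f x))"

lemma exact_step_exact_line_search:
  fixes B :: "real ^ 'n ^ 'n"
  assumes B: "spd B" and x: "x \<noteq> xstar"
    and d: "d = - (matrix_inv B *v grad f x)"
    and min: "is_arg_min (\<lambda>\<eta>. f (x + \<eta> *\<^sub>R d)) (\<lambda>\<eta>. 0 \<le> \<eta>) \<eta>"
  shows "exact_step B x (\<eta> *\<^sub>R d)"
proof -
  have \<eta>: "0 \<le> \<eta>" and le: "\<And>t. 0 \<le> t \<Longrightarrow> f (x + \<eta> *\<^sub>R d) \<le> f (x + t *\<^sub>R d)"
    using min by (auto simp: is_arg_min_def not_less)
  have "B *v d = - ((B ** matrix_inv B) *v grad f x)"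
    by (simp add: d matrix_vector_mul_assoc[symmetric] vec.neg)
  then have Bd: "B *v d = - grad f x"
    by (simp add: matrix_inv_right_inverse[OF spd_invertible[OF B]])
  then have d0: "d \<noteq> 0" using grad_nonzero[OF x] by auto
  have desc: "d \<bullet> grad f x < 0" using spd_pos[OF B d0] Bd by simp
  \<comment> \<open>The direction is a strict descent direction, so a zero step would not be minimal.\<close>
  have "\<eta> \<noteq> 0"
  proof
    assume "\<eta> = 0"
    have "\<exists>e>0. \<forall>h>0. h < e \<longrightarrow> f (x + (0 + h) *\<^sub>R d) < f (x + 0 *\<^sub>R d)"
      by (rule DERIV_neg_dec_right[OF line_derivative[OF smooth]]) (use desc in simp)
    then obtain e where e: "e > 0"
      "\<And>h. 0 < h \<Longrightarrow> h < e \<Longrightarrow> f (x + (0 + h) *\<^sub>R d) < f (x + 0 *\<^sub>R d)" by blast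
    show False using e(2)[of "e / 2"] le[of "e / 2"] e(1) \<open>\<eta> = 0\<close> by simp
  qed
  with \<eta> have \<eta>: "0 < \<eta>" by simp
  have "d \<bullet> grad f (x + \<eta> *\<^sub>R d) = 0"
    by (rule DERIV_local_min[OF line_derivative[OF smooth] \<eta>]) (auto intro!: le)
  moreover have "f (x + \<eta> *\<^sub>R d) \<le> f x" using le[of 0] by simp
  ultimately show ?thesis
    using \<eta> desc Bd
    by (auto simp: exact_step_def inner_diff_right matrix_vector_mult_scaleR mult_less_0_iff)
qed

text \<open>
  For a quadratic function the decrease is half of \<open>s \<bullet> y\<close>. In general both are Hessian forms at two points
  of the segment, which agree up to the factor \<open>1 + 2 hess_dev x\<close>.
\<close>

lemma decrease_ge_hess_dev:
  assumes "exact_step B x s"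
  shows "s \<bullet> (grad f (x + s) - grad f x) \<le> 2 * (1 + 2 * hess_dev x) * (f x - f (x + s))"
proof -
  have opt: "s \<bullet> grad f (x + s) = 0" and dec: "f (x + s) \<le> f x"
    using assms by (auto simp: exact_step_def)
  obtain t where t: "0 < t" "t < 1" "f ((x + s) + - s) = f (x + s) + (- s) \<bullet> grad f (x + s)
      + (- s) \<bullet> (hess f ((x + s) + t *\<^sub>R (- s)) *v (- s)) / 2"
    using taylor_second_order[OF smooth] by blast
  define z where "z = (x + s) + t *\<^sub>R (- s)"
  have fz: "f z \<le> f x" unfolding z_def by (rule segment_le) (use t dec in auto)
  have z: "f x = f (x + s) + s \<bullet> (hess f z *v s) / 2"
    using t(3) opt by (simp add: z_def vec.neg)
  obtain r where r: "0 < r" "r < 1" and w: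
    "s \<bullet> (grad f (x + s) - grad f x) = s \<bullet> (hess f (x + r *\<^sub>R s) *v s)"
    using grad_mean_value[OF smooth] by blast
  have fw: "f (x + r *\<^sub>R s) \<le> f x" by (rule segment_le) (use r dec in auto)
  have "s \<bullet> (hess f z *v s) = 2 * (f x - f (x + s))" using z by simp
  then show ?thesis using hess_le_hess[OF fw fz, of s] w by (simp only: mult.assoc mult.left_commute[of _ 2])
qed

text \<open>
  Stationarity at the end of the step gives \<open>s \<bullet> grad f x = - (s \<bullet> y)\<close>, and the step length cancels.
\<close>

lemma alignment_exact_step:
  assumes step: "exact_step B x s"
  shows "alignment W B s (grad f (x + s) - grad f x)
    = s \<bullet> (grad f (x + s) - grad f x) / (grad f x \<bullet> (W *v grad f x))"
proof -
  define g y where "g = grad f x" and "y = grad f (x + s) - grad f x"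
  obtain \<eta> where \<eta>: "\<eta> > 0" "B *v s = - (\<eta> *\<^sub>R g)" and sy: "0 < s \<bullet> y" and
    opt: "s \<bullet> grad f (x + s) = 0"
    using step by (auto simp: exact_step_def g_def y_def)
  have "s \<bullet> g = - (s \<bullet> y)" using opt by (simp add: y_def g_def inner_diff_right)
  then have "alignment W B s y = (\<eta> * (s \<bullet> y))\<^sup>2 / (\<eta> * (\<eta> * (g \<bullet> (W *v g))) * (s \<bullet> y))"
    by (simp add: alignment_def \<eta> vec.neg matrix_vector_mult_scaleR)
  also have "\<dots> = s \<bullet> y / (g \<bullet> (W *v g))"
    using \<eta> sy by (simp add: power2_eq_square)
  finally show ?thesis by (simp add: g_def y_def)
qed

text \<open>
  The relative decrease factors into the decrease compared with \<open>s \<bullet> y\<close>, the alignment, and the weighted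
  squared gradient compared with the gap.
\<close>

lemma exact_step_decrease_ratio:
  assumes step: "exact_step B x s" and x: "x \<noteq> xstar" and W: "spd W"
    and m: "m > 0" "s \<bullet> (grad f (x + s) - grad f x) \<le> m * (f x - f (x + s))"
    and a: "a * gap x \<le> grad f x \<bullet> (W *v grad f x)"
  shows "alignment W B s (grad f (x + s) - grad f x) * a / m \<le> (f x - f (x + s)) / gap x"
proof -
  define q y where "q = grad f x \<bullet> (W *v grad f x)" and "y = grad f (x + s) - grad f x"
  have q: "q > 0" using spd_pos[OF W grad_nonzero[OF x]] by (simp add: q_def)
  have sy: "s \<bullet> y > 0" using step by (simp add: exact_step_def y_def)
  have gap: "gap x > 0" by (rule gap_pos[OF x])
  have al: "alignment W B s y = s \<bullet> y / q"
    using alignment_exact_step[OF step] by (simp add: q_def y_def)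
  have "alignment W B s y * a * gap x = (s \<bullet> y / q) * (a * gap x)" by (simp add: al)
  also have "\<dots> \<le> (s \<bullet> y / q) * q" using a sy q by (intro mult_left_mono) (auto simp: q_def)
  also have "\<dots> \<le> m * (f x - f (x + s))" using m q by (simp add: y_def)
  finally have "alignment W B s y * a / m \<le> (f x - f (x + s)) / gap x"
    using gap m(1) by (simp add: field_simps)
  then show ?thesis by (simp add: y_def)
qed

text \<open>
  For a quadratic function with Hessian \<open>H\<close>, twice the gap equals the weighted squared gradient. One factor
  \<open>1 + hess_dev x\<close> is lost in the Taylor expansion of the gap, two more in comparing the gradient with
  \<open>H (x - xstar)\<close>.
\<close>

lemma gap_le_weighted_grad:
  assumes W: "W ** hess f xstar = mat 1" and x: "x \<noteq> xstar"
  shows "2 / (1 + hess_dev x) ^ 3 * gap x \<le> grad f x \<bullet> (W *v grad f x)"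
proof -
  define c g e H where "c = 1 + hess_dev x" and "g = grad f x" and "e = x - xstar" and "H = hess f xstar"
  have c: "c > 0" using hess_dev_nonneg[of x] by (simp add: c_def)
  define E where "E = e \<bullet> (H *v e)"
  have E: "E > 0" using spd_pos[OF spd_hess, of e xstar] x by (simp add: E_def H_def e_def)
  have seg: "f (xstar + t *\<^sub>R e) \<le> f x" if "0 < t" "t < 1" for t
    by (rule segment_le) (use that minimizer in \<open>auto simp: e_def\<close>)
  obtain t where t: "0 < t" "t < 1"
    "f (xstar + e) = f xstar + e \<bullet> grad f xstar + e \<bullet> (hess f (xstar + t *\<^sub>R e) *v e) / 2"
    using taylor_second_order[OF smooth] by blast
  then have gap: "2 * gap x \<le> c * E"
    using hess_le_star[OF seg[OF t(1,2)], of e]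
    by (simp add: gap_def grad_minimizer e_def c_def E_def H_def)
  obtain r where r: "0 < r" "r < 1" and
    "e \<bullet> (grad f (xstar + e) - grad f xstar) = e \<bullet> (hess f (xstar + r *\<^sub>R e) *v e)"
    using grad_mean_value[OF smooth] by blast
  then have "E \<le> c * (e \<bullet> g)"
    using hess_star_le[OF seg[OF r], of e]
    by (simp add: grad_minimizer e_def c_def E_def H_def g_def)
  then have "E\<^sup>2 \<le> c\<^sup>2 * (e \<bullet> g)\<^sup>2"
    using power_mono[of E "c * (e \<bullet> g)" 2] E by (simp add: power_mult_distrib)
  also have "c\<^sup>2 * (e \<bullet> g)\<^sup>2 \<le> c\<^sup>2 * ((g \<bullet> (W *v g)) * E)"
  proof (rule mult_left_mono)
    have "W *v (H *v e) = e" using W by (simp add: matrix_vector_mul_assoc H_def)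
    then show "(e \<bullet> g)\<^sup>2 \<le> (g \<bullet> (W *v g)) * E"
      using spd_cauchy_schwarz[OF spd_left_inverse[OF spd_hess W], of g "H *v e"]
      by (simp add: E_def inner_commute)
  qed simp
  finally have "E * E \<le> (c\<^sup>2 * (g \<bullet> (W *v g))) * E"
    by (simp add: power2_eq_square mult_ac)
  then have "c * E \<le> c * (c\<^sup>2 * (g \<bullet> (W *v g)))" using E c by simp
  then have "2 * gap x \<le> c ^ 3 * (g \<bullet> (W *v g))"
    using gap by (simp add: power2_eq_square power3_eq_cube mult_ac)
  then show ?thesis using c by (simp add: c_def[symmetric] g_def field_simps)
qed

lemma curvature_star:
  fixes x s :: "real ^ 'n"
  assumes W: "W ** hess f xstar = mat 1" and dec: "f (x + s) \<le> f x"
  defines "y \<equiv> grad f (x + s) - grad f x"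
  shows "y \<bullet> (W *v y) \<le> (1 + hess_dev x) * (s \<bullet> y)"
proof -
  have HW: "hess f xstar ** W = mat 1" using W matrix_left_right_inverse by blast
  have "(W *v y) \<bullet> y \<le> (1 + hess_dev x) * (s \<bullet> y)"
    unfolding y_def
  proof (rule grad_diff_cocoercive)
    show "0 < 1 + hess_dev x" using hess_dev_nonneg[of x] by simp
    fix t :: real assume t: "0 < t" "t < 1"
    have "f (x + t *\<^sub>R s) \<le> f x" by (rule segment_le) (use t dec in auto)
    from hess_le_star[OF this, of "W *v y"]
    show "(W *v (grad f (x + s) - grad f x)) \<bullet> (hess f (x + t *\<^sub>R s) *v (W *v (grad f (x + s) - grad f x)))
      \<le> (1 + hess_dev x) * ((W *v (grad f (x + s) - grad f x)) \<bullet> (grad f (x + s) - grad f x))"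
      by (simp add: matrix_vector_mul_assoc HW y_def)
  qed
  then show ?thesis by (simp add: inner_commute)
qed

lemma curvature_L:
  fixes x s :: "real ^ 'n"
  defines "y \<equiv> grad f (x + s) - grad f x"
  shows "y \<bullet> y \<le> L * (s \<bullet> y)"
  unfolding y_def by (rule grad_diff_cocoercive[OF L_pos hess_le])

end

section \<open>Scalar estimates\<close>


lemma prod_le_mean_power:
  fixes r :: "nat \<Rightarrow> real"
  assumes r: "\<And>i. i < k \<Longrightarrow> r i \<ge> 0" and A: "(\<Sum>i<k. r i) \<le> A" and k: "k \<ge> 1"
  shows "(\<Prod>i<k. r i) \<le> (A / k) ^ k"
proof -
  define P where "P = (\<Prod>i<k. r i)"
  have P: "P \<ge> 0" unfolding P_def using r by (intro prod_nonneg) auto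
  have "P powr (1 / k) \<le> (\<Sum>i<k. r i / k)"
    using arith_geom_mean[of "{..<k}" r] k r by (auto simp: P_def lessThan_empty_iff)
  also have "\<dots> \<le> A / k"
    using A by (simp add: sum_divide_distrib[symmetric] divide_right_mono)
  finally have le: "P powr (1 / k) \<le> A / k" .
  have "P = (P powr (1 / k)) ^ k"
  proof (cases "P = 0")
    case True
    then show ?thesis using k by simp
  next
    case False
    then have "(P powr (1 / k)) ^ k = P powr (1 / k * k)"
      using P by (simp add: powr_powr powr_realpow[symmetric])
    then show ?thesis using k P by simp
  qed
  also have "\<dots> \<le> (A / k) ^ k" by (rule power_mono[OF le]) simp
  finally show ?thesis by (simp add: P_def)
qed

lemma sum_exp_geometric_le:
  fixes u :: real
  assumes u: "u > 0"
  shows "(\<Sum>i<k. exp (- (u * real i))) \<le> 1 + 1 / u"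
proof -
  define q where "q = exp (- u)"
  have q: "0 < q" "q < 1" using u by (auto simp: q_def)
  have "(1 + u) * q \<le> exp u * q" using q by (intro mult_right_mono) auto
  also have "\<dots> = 1" by (simp add: q_def exp_minus)
  finally have "1 / (1 - q) \<le> 1 + 1 / u" using q u by (simp add: field_simps)
  moreover have "(\<Sum>i<k. exp (- (u * real i))) = (\<Sum>i<k. q ^ i)"
    by (simp add: q_def exp_of_nat_mult[symmetric] mult.commute)
  moreover have "(\<Sum>i<k. q ^ i) = (1 - q ^ k) / (1 - q)" using q by (simp add: sum_gp_strict)
  moreover have "\<dots> \<le> 1 / (1 - q)" using q by (intro divide_right_mono) auto
  ultimately show ?thesis by linarith
qed

text \<open>
  The bound on \<open>z\<close> is useless for the first \<open>T\<close> indices, which contribute at most \<open>T + 1\<close>; from then on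
  \<open>2 i - T \<ge> i\<close> and the terms decay geometrically.
\<close>

lemma sum_delayed_geometric_le:
  fixes z :: "nat \<Rightarrow> real"
  assumes u: "u > 0" and T: "T \<ge> 0"
    and z1: "\<And>i. z i \<le> 1" and z: "\<And>i. z i \<le> exp (- (u * (2 * real i - T)))"
  shows "(\<Sum>i<k. z i) \<le> T + 2 + 1 / u"
proof -
  have "z i \<le> of_bool (real i < T) + exp (- (u * real i))" for i
  proof (cases "real i < T")
    case False
    then have "u * real i \<le> u * (2 * real i - T)" using u by (intro mult_left_mono) auto
    then have "exp (- (u * (2 * real i - T))) \<le> exp (- (u * real i))" by simp
    then have "z i \<le> exp (- (u * real i))" using z[of i] by (rule order_trans[rotated])
    then show ?thesis using False by simp
  qed (use z1[of i] in \<open>simp add: add_increasing2\<close>)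
  then have "(\<Sum>i<k. z i) \<le> (\<Sum>i<k. of_bool (real i < T)) + (\<Sum>i<k. exp (- (u * real i)))"
    unfolding sum.distrib[symmetric] by (intro sum_mono)
  also have "(\<Sum>i<k. of_bool (real i < T)) = real (card {i \<in> {..<k}. real i < T})"
    by (simp add: of_bool_def sum.If_cases Int_def)
  also have "\<dots> \<le> real (card {..<nat \<lceil>T\<rceil>})"
    by (intro of_nat_mono card_mono) (auto simp: less_ceiling_iff zless_nat_eq_int_zless)
  also have "\<dots> \<le> T + 1" using T by (simp add: of_nat_nat)
  finally show ?thesis using sum_exp_geometric_le[OF u, of k] by linarith
qed



section \<open>Convergence of the BFGS iterates\<close>

locale bfgs_run = hessian_lipschitz_at_minimizer f \<mu> L xstar M
  for f :: "real ^ 'n \<Rightarrow> real" and \<mu> L :: real and xstar :: "real ^ 'n" and M :: real +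
  fixes x :: "nat \<Rightarrow> real ^ 'n" and B :: "nat \<Rightarrow> real ^ 'n ^ 'n" and \<alpha> :: real
  assumes \<alpha>_pos: "\<alpha> > 0"
    and B_0: "B 0 = \<alpha> *\<^sub>R mat 1"
    and bfgs: "bfgs_exact f x B"
    and not_optimal: "\<And>j. x j \<noteq> xstar"
begin

definition step :: "nat \<Rightarrow> real ^ 'n" where
  "step k = x (Suc k) - x k"

definition grad_change :: "nat \<Rightarrow> real ^ 'n" where
  "grad_change k = grad f (x (Suc k)) - grad f (x k)"

definition ratio :: "nat \<Rightarrow> real" where
  "ratio k = gap (x (Suc k)) / gap (x k)"

lemma x_plus_step: "x k + step k = x (Suc k)"
  by (simp add: step_def)

lemma B_Suc: "B (Suc k) = bfgs_update (B k) (step k) (grad_change k)"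
  using bfgs by (simp add: bfgs_exact_def Let_def step_def grad_change_def)

lemma exact_step_if_spd:
  assumes "spd (B k)"
  shows "exact_step (B k) (x k) (step k)"
proof -
  define d where "d = - (matrix_inv (B k) *v grad f (x k))"
  obtain \<eta> where min: "is_arg_min (\<lambda>\<eta>. f (x k + \<eta> *\<^sub>R d)) (\<lambda>\<eta>. 0 \<le> \<eta>) \<eta>"
    and \<eta>: "x (Suc k) = x k + \<eta> *\<^sub>R d"
    using bfgs unfolding bfgs_exact_def Let_def d_def by blast
  show ?thesis
    using exact_step_exact_line_search[OF assms not_optimal d_def min] \<eta> by (simp add: step_def)
qed

lemma exact_step_change_pos:
  "exact_step (B k) (x k) (step k) \<Longrightarrow> 0 < step k \<bullet> grad_change k"
  by (simp add: exact_step_def x_plus_step grad_change_def)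

text \<open>
  Positive definiteness of \<open>B k\<close> makes the search direction a descent direction; the exact line search then
  gives positive curvature, which in turn preserves positive definiteness.
\<close>

lemma spd_B: "spd (B k)"
proof (induction k)
  case 0
  then show ?case using \<alpha>_pos by (simp add: B_0 spd_scaleR_mat)
next
  case (Suc k)
  then show ?case
    unfolding B_Suc by (intro spd_bfgs_update exact_step_change_pos exact_step_if_spd)
qed

lemma step_exact: "exact_step (B k) (x k) (step k)"
  by (rule exact_step_if_spd[OF spd_B])

lemma step_change_pos: "0 < step k \<bullet> grad_change k"
  by (rule exact_step_change_pos[OF step_exact])

lemma f_Suc_le: "f (x (Suc k)) \<le> f (x k)"
  using step_exact[of k] by (simp add: exact_step_def x_plus_step)

lemma gap_le_initial: "gap (x k) \<le> gap (x 0)"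
proof (induction k)
  case (Suc k)
  then show ?case using f_Suc_le[of k] by (simp add: gap_def)
qed simp

lemma hess_dev_eq: "hess_dev (x k) = hess_dev (x 0) * sqrt (gap (x k) / gap (x 0))"
  using gap_pos[OF not_optimal, of 0]
  by (simp add: hess_dev_def real_sqrt_mult real_sqrt_divide)

lemma hess_dev_le_initial: "hess_dev (x k) \<le> hess_dev (x 0)"
  using gap_le_initial[of k] M_pos \<mu>_pos
  by (simp add: hess_dev_def divide_right_mono mult_left_mono)

lemma ratio_pos: "0 < ratio k"
  using gap_pos[OF not_optimal] by (simp add: ratio_def)

lemma prod_ratio: "(\<Prod>i<k. ratio i) = gap (x k) / gap (x 0)"
  using gap_pos[OF not_optimal]
  by (induction k) (simp_all add: ratio_def less_imp_neq[THEN not_sym])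

lemma one_minus_ratio: "1 - ratio k = (f (x k) - f (x (Suc k))) / gap (x k)"
  using gap_pos[OF not_optimal, of k] by (simp add: ratio_def gap_def field_simps)

lemma alignment_pos:
  assumes "spd W"
  shows "0 < alignment W (B k) (step k) (grad_change k)"
proof -
  have "step k \<noteq> 0" using step_change_pos[of k] by auto
  then have "0 < step k \<bullet> (B k *v step k)" by (rule spd_pos[OF spd_B])
  moreover from this have "B k *v step k \<noteq> 0" by auto
  then have "0 < (B k *v step k) \<bullet> (W *v (B k *v step k))" by (rule spd_pos[OF assms])
  ultimately show ?thesis using step_change_pos[of k] by (simp add: alignment_def)
qed

lemma ln_one_minus_ratio_ge:
  assumes W: "spd W" and m: "m > 0" and a: "a > 0"
    and dec: "step k \<bullet> grad_change k \<le> m * (f (x k) - f (x (Suc k)))"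
    and gr: "a * gap (x k) \<le> grad f (x k) \<bullet> (W *v grad f (x k))"
  shows "ln (alignment W (B k) (step k) (grad_change k)) + ln (a / m) \<le> ln (1 - ratio k)"
proof -
  define A where "A = alignment W (B k) (step k) (grad_change k)"
  have A: "A > 0" unfolding A_def by (rule alignment_pos[OF W])
  have "A * a / m \<le> 1 - ratio k"
    unfolding one_minus_ratio A_def grad_change_def x_plus_step[symmetric]
    by (rule exact_step_decrease_ratio[OF step_exact not_optimal W m _ gr])
       (use dec in \<open>simp add: grad_change_def x_plus_step\<close>)
  moreover have "0 < A * (a / m)" using A a m by simp
  ultimately have "0 < 1 - ratio k" and "A * (a / m) \<le> 1 - ratio k" by auto
  then show "ln A + ln (a / m) \<le> ln (1 - ratio k)"
    using A a m by (auto simp flip: ln_mult_pos)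
qed

text \<open>
  Telescoping the potential from its explicit value at \<open>\<alpha> I\<close> down to its minimum. The numbers \<open>\<epsilon> i\<close> are the
  relative curvature errors of the updates in the metric of \<open>W\<close>.
\<close>

lemma sum_ln_alignment_ge:
  fixes W H :: "real ^ 'n ^ 'n"
  assumes H: "spd H" and WH: "W ** H = mat 1"
    and tr: "trace W \<le> real CARD('n) / \<nu>" and det: "ln \<bar>det H\<bar> \<le> real CARD('n) * ln L"
    and curv: "\<And>i. i < k \<Longrightarrow>
      grad_change i \<bullet> (W *v grad_change i) \<le> (1 + \<epsilon> i) * (step i \<bullet> grad_change i)"
  shows "- (real CARD('n) * (\<alpha> / \<nu> - 1 + ln (L / \<alpha>))) - (\<Sum>i<k. \<epsilon> i)
    \<le> (\<Sum>i<k. ln (alignment W (B i) (step i) (grad_change i)))"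
proof -
  define a where "a i = alignment W (B i) (step i) (grad_change i)" for i
  have W: "spd W" by (rule spd_left_inverse[OF H WH])
  have "potential W (B k) \<le> potential W (B 0) + (\<Sum>i<k. \<epsilon> i) + (\<Sum>i<k. ln (a i))"
    using curv
  proof (induction k)
    case (Suc k)
    have "grad_change k \<bullet> (W *v grad_change k) / (step k \<bullet> grad_change k) \<le> 1 + \<epsilon> k"
      using Suc.prems[of k] step_change_pos[of k] by (simp add: divide_le_eq)
    then have "potential W (B (Suc k)) \<le> potential W (B k) + \<epsilon> k + ln (a k)"
      using potential_bfgs_update[OF spd_B[of k] W step_change_pos[of k]] by (simp add: B_Suc a_def)
    then show ?case using Suc by simp
  qed simp
  moreover have "potential W (B 0) \<le> \<alpha> * (real CARD('n) / \<nu>) - real CARD('n) * ln \<alpha>"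
  proof -
    have "trace (W ** (\<alpha> *\<^sub>R mat 1)) = \<alpha> * trace W"
      by (simp add: trace_def matrix_matrix_mult_def mat_def sum_distrib_left mult.commute
          if_distrib[of "\<lambda>c. _ * c"] cong: if_cong)
    moreover have "\<alpha> * trace W \<le> \<alpha> * (real CARD('n) / \<nu>)"
      using tr \<alpha>_pos by (intro mult_left_mono) auto
    ultimately show ?thesis
      using \<alpha>_pos by (simp add: potential_def B_0 det_scaleR_mat ln_realpow power_abs[symmetric])
  qed
  moreover have "real CARD('n) - real CARD('n) * ln L \<le> potential W (B k)"
    using potential_minimal[OF H WH spd_B, of k] det by linarith
  moreover have "real CARD('n) * (\<alpha> / \<nu> - 1 + ln (L / \<alpha>)) = \<alpha> * (real CARD('n) / \<nu>)
      - real CARD('n) + (real CARD('n) * ln L - real CARD('n) * ln \<alpha>)"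
    using L_pos \<alpha>_pos by (simp add: ln_div algebra_simps)
  ultimately show ?thesis unfolding a_def by linarith
qed

definition line_search_const :: real where
  "line_search_const = min (2 * (1 + 2 * hess_dev (x 0))) (1 + sqrt (L / \<mu>))"

lemma line_search_const_ge: "2 \<le> line_search_const"
proof -
  have "1 \<le> L / \<mu>" using \<mu>_le_L \<mu>_pos by simp
  then have "1 \<le> sqrt (L / \<mu>)" by simp
  then show ?thesis using hess_dev_nonneg by (simp add: line_search_const_def)
qed

lemma decrease_line_search_const:
  "step k \<bullet> grad_change k \<le> line_search_const * (f (x k) - f (x (Suc k)))"
proof -
  define D where "D = f (x k) - f (x (Suc k))"
  have D: "D \<ge> 0" using f_Suc_le by (simp add: D_def)
  have "step k \<bullet> grad_change k \<le> 2 * (1 + 2 * hess_dev (x k)) * D"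
    using decrease_ge_hess_dev[OF step_exact[of k]]
    by (simp add: D_def grad_change_def x_plus_step)
  also have "\<dots> \<le> 2 * (1 + 2 * hess_dev (x 0)) * D"
    using hess_dev_le_initial[of k] D by (intro mult_right_mono) auto
  finally have "step k \<bullet> grad_change k \<le> 2 * (1 + 2 * hess_dev (x 0)) * D" .
  moreover have "step k \<bullet> grad_change k \<le> (1 + sqrt (L / \<mu>)) * D"
    using decrease_ge_condition_number[of "step k" "x k"] step_exact[of k]
    by (simp add: D_def grad_change_def x_plus_step exact_step_def)
  ultimately show ?thesis by (simp add: line_search_const_def min_def D_def)
qed

lemma ratio_less_1: "0 < 1 - ratio k"
proof -
  have "0 < line_search_const * (f (x k) - f (x (Suc k)))"
    using step_change_pos[of k] decrease_line_search_const[of k] by linarith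
  then have "0 < f (x k) - f (x (Suc k))"
    using line_search_const_ge by (simp add: zero_less_mult_iff)
  then show ?thesis using gap_pos[OF not_optimal] by (simp add: one_minus_ratio)
qed

text \<open>
  The excess of the potential with weight \<open>I / L\<close> at \<open>\<alpha> I\<close> over its minimum.
\<close>

definition \<Psi>_L :: real where
  "\<Psi>_L = real CARD('n) * (\<alpha> / L - 1 + ln (L / \<alpha>))"

lemma \<Psi>_L_nonneg: "0 \<le> \<Psi>_L"
proof -
  have "ln (\<alpha> / L) \<le> \<alpha> / L - 1" using \<alpha>_pos L_pos by (intro ln_le_minus_one) simp
  moreover have "ln (\<alpha> / L) = - ln (L / \<alpha>)" using \<alpha>_pos L_pos by (simp add: ln_div)
  ultimately show ?thesis by (simp add: \<Psi>_L_def)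
qed

text \<open>
  With weight \<open>I / L\<close> the logarithms of \<open>(1 - ratio i) / q\<close> sum to at least \<open>- \<Psi>_L\<close> for a constant \<open>q\<close>.
  Bounding each \<open>ln (1 - ratio i)\<close> by the tangent of the logarithm at \<open>q / 3\<close> turns this into a lower
  bound on the sum of the \<open>1 - ratio i\<close>. The divisor 3 is chosen because \<open>ln 3 \<ge> 1\<close>: each iteration then gains
  \<open>2\<close> against the delay \<open>\<Psi>_L\<close>, which is what \<open>sum_delayed_geometric_le\<close> expects.
\<close>

lemma gap_linear_decay:
  "gap (x k) / gap (x 0)
    \<le> exp (- (2 * (2 * real k - \<Psi>_L) / (3 * (L / \<mu> * line_search_const))))"
proof -
  define m where "m = line_search_const"
  \<comment> \<open>The factor from the inequality of Polyak and Lojasiewicz divided by the line search constant.\<close>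
  define q where "q = 2 * \<mu> / L / m"
  define a where "a i = alignment ((1 / L) *\<^sub>R mat 1) (B i) (step i) (grad_change i)" for i
  have m: "m > 0" using line_search_const_ge by (simp add: m_def)
  have q: "q > 0" using m \<mu>_pos L_pos by (simp add: q_def)
  have L: "spd ((1 / L) *\<^sub>R mat 1 :: real ^ 'n ^ 'n)" "spd (L *\<^sub>R mat 1 :: real ^ 'n ^ 'n)"
    using L_pos by (auto intro: spd_scaleR_mat)
  have "- \<Psi>_L - (\<Sum>i<k. 0) \<le> (\<Sum>i<k. ln (a i))"
    unfolding \<Psi>_L_def a_def
  proof (rule sum_ln_alignment_ge[OF L(2)])
    show "(1 / L) *\<^sub>R mat 1 ** (L *\<^sub>R mat 1) = (mat 1 :: real ^ 'n ^ 'n)"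
      using L_pos by (simp add: matrix_eq matrix_vector_mul_assoc[symmetric]
          scaleR_matrix_vector_assoc[symmetric] matrix_vector_mult_scaleR)
    show "trace ((1 / L) *\<^sub>R mat 1 :: real ^ 'n ^ 'n) \<le> real CARD('n) / L"
      by (simp add: trace_def mat_def)
    show "ln \<bar>det (L *\<^sub>R mat 1 :: real ^ 'n ^ 'n)\<bar> \<le> real CARD('n) * ln L"
      using L_pos by (simp add: det_scaleR_mat ln_realpow)
    fix i
    have "grad_change i \<bullet> grad_change i \<le> L * (step i \<bullet> grad_change i)"
      using curvature_L[of "x i" "step i"] by (simp add: grad_change_def x_plus_step)
    then show "grad_change i \<bullet> ((1 / L) *\<^sub>R mat 1 *v grad_change i) \<le> (1 + 0) * (step i \<bullet> grad_change i)"
      using L_pos by (simp add: scaleR_matrix_vector_assoc[symmetric] divide_le_eq mult.commute)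
  qed
  moreover have "ln (a i) + ln q \<le> ln (1 - ratio i)" for i
    unfolding a_def q_def
  proof (rule ln_one_minus_ratio_ge[OF L(1) m])
    show "2 * \<mu> / L * gap (x i) \<le> grad f (x i) \<bullet> ((1 / L) *\<^sub>R mat 1 *v grad f (x i))"
      using gap_le_grad[of "x i"] L_pos
      by (simp add: scaleR_matrix_vector_assoc[symmetric] divide_right_mono)
  qed (use \<mu>_pos L_pos decrease_line_search_const in \<open>auto simp: m_def\<close>)
  then have "(\<Sum>i<k. ln (a i) + ln q) \<le> (\<Sum>i<k. ln (1 - ratio i))" by (rule sum_mono)
  moreover have "ln (1 - ratio i) \<le> 3 / q * (1 - ratio i) - 2 + ln q" for i
  proof -
    define w where "w = 1 - ratio i"
    have w: "0 < w" unfolding w_def by (rule ratio_less_1)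
    have "ln (3 * w / q) \<le> 3 * w / q - 1"
      using w q by (intro ln_le_minus_one) simp
    moreover have "ln (3 * w / q) = ln 3 + ln w - ln q"
      using w q by (simp add: ln_div ln_mult_pos)
    moreover have "ln (exp 1) \<le> ln (3 :: real)" using exp_le by (subst ln_le_cancel_iff) auto
    ultimately show ?thesis by (simp add: w_def[symmetric])
  qed
  then have "(\<Sum>i<k. ln (1 - ratio i)) \<le> (\<Sum>i<k. 3 / q * (1 - ratio i) - 2 + ln q)"
    by (rule sum_mono)
  ultimately have "2 * real k - \<Psi>_L \<le> 3 / q * (\<Sum>i<k. 1 - ratio i)"
    by (simp add: sum.distrib sum_subtractf sum_distrib_left right_diff_distrib mult.commute[of "real k"])
  then have "q / 3 * (2 * real k - \<Psi>_L) \<le> q / 3 * (3 / q * (\<Sum>i<k. 1 - ratio i))"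
    using q by (intro mult_left_mono) auto
  also have "\<dots> = (\<Sum>i<k. 1 - ratio i)" using q by simp
  finally have sum: "q / 3 * (2 * real k - \<Psi>_L) \<le> (\<Sum>i<k. 1 - ratio i)" .
  have "gap (x k) / gap (x 0) = (\<Prod>i<k. ratio i)" by (simp add: prod_ratio)
  also have "\<dots> \<le> (\<Prod>i<k. exp (- (1 - ratio i)))"
    using ratio_pos exp_ge_add_one_self[of "ratio _ - 1"]
    by (intro prod_mono) (auto simp: less_imp_le)
  also have "\<dots> = exp (- (\<Sum>i<k. 1 - ratio i))"
    by (simp add: exp_sum[symmetric] sum_negf[symmetric])
  also have "\<dots> \<le> exp (- (q / 3 * (2 * real k - \<Psi>_L)))" using sum by simp
  also have "q / 3 * (2 * real k - \<Psi>_L) = 2 * (2 * real k - \<Psi>_L) / (3 * (L / \<mu> * m))"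
    using \<mu>_pos L_pos m by (simp add: q_def field_simps)
  finally show ?thesis by (simp add: m_def)
qed

text \<open>
  The deviations are proportional to the square roots of the gaps, so the exponential rate is halved.
\<close>

lemma sum_hess_dev_le:
  "(\<Sum>i<k. hess_dev (x i)) \<le> hess_dev (x 0) * (\<Psi>_L + 2 + 3 * (L / \<mu> * line_search_const))"
proof -
  define K where "K = L / \<mu> * line_search_const"
  have K: "K > 0" using line_search_const_ge L_pos \<mu>_pos by (simp add: K_def)
  have "(\<Sum>i<k. sqrt (gap (x i) / gap (x 0))) \<le> \<Psi>_L + 2 + 1 / (1 / (3 * K))"
  proof (rule sum_delayed_geometric_le)
    fix i
    show "sqrt (gap (x i) / gap (x 0)) \<le> 1"
      using gap_le_initial[of i] gap_pos[OF not_optimal, of 0] by simp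
    have "sqrt (gap (x i) / gap (x 0)) \<le> sqrt (exp (- (2 * (2 * real i - \<Psi>_L) / (3 * K))))"
      using gap_linear_decay[of i] unfolding K_def by (rule real_sqrt_le_mono)
    also have "\<dots> = sqrt ((exp (- (1 / (3 * K) * (2 * real i - \<Psi>_L))))\<^sup>2)"
      by (simp add: power2_eq_square exp_add[symmetric])
    also have "\<dots> = exp (- (1 / (3 * K) * (2 * real i - \<Psi>_L)))"
      by (simp add: real_sqrt_unique)
    finally show "sqrt (gap (x i) / gap (x 0)) \<le> exp (- (1 / (3 * K) * (2 * real i - \<Psi>_L)))" .
  qed (use K \<Psi>_L_nonneg in auto)
  then have "hess_dev (x 0) * (\<Sum>i<k. sqrt (gap (x i) / gap (x 0))) \<le> hess_dev (x 0) * (\<Psi>_L + 2 + 3 * K)"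
    using hess_dev_nonneg by (intro mult_left_mono) auto
  moreover have "(\<Sum>i<k. hess_dev (x i)) = hess_dev (x 0) * (\<Sum>i<k. sqrt (gap (x i) / gap (x 0)))"
    unfolding sum_distrib_left by (intro sum.cong refl hess_dev_eq)
  ultimately show ?thesis by (simp add: K_def)
qed

text \<open>
  For \<open>u = W e\<close> with a coordinate vector \<open>e\<close>, the Hessian bound \<open>\<mu> (u \<bullet> u) \<le> u \<bullet> e\<close> and the square of
  \<open>\<mu> u - e\<close> bound the diagonal entry \<open>u \<bullet> e\<close>.
\<close>

lemma trace_inverse_hess_le:
  fixes W :: "real ^ 'n ^ 'n"
  assumes W: "W ** hess f xstar = mat 1"
  shows "trace W \<le> real CARD('n) / \<mu>"
proof -
  have "W $ i $ i \<le> 1 / \<mu>" for i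
  proof -
    define e u where "e = (axis i 1 :: real ^ 'n)" and "u = W *v e"
    have "hess f xstar ** W = mat 1" using W matrix_left_right_inverse by blast
    then have Hu: "hess f xstar *v u = e" by (simp add: u_def matrix_vector_mul_assoc)
    have "0 \<le> (\<mu> *\<^sub>R u - e) \<bullet> (\<mu> *\<^sub>R u - e)" by simp
    also have "\<dots> = \<mu> * (\<mu> * (u \<bullet> u)) - 2 * \<mu> * (u \<bullet> e) + 1"
      by (simp add: inner_diff_left inner_diff_right inner_commute e_def inner_axis_axis algebra_simps)
    also have "\<mu> * (\<mu> * (u \<bullet> u)) \<le> \<mu> * (u \<bullet> e)"
      using hess_ge[of u xstar] \<mu>_pos by (simp add: Hu)
    finally have "\<mu> * (u \<bullet> e) \<le> 1" by simp
    moreover have "u \<bullet> e = W $ i $ i"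
      by (simp add: u_def e_def inner_axis matrix_vector_mul_component inner_axis')
    ultimately show ?thesis using \<mu>_pos by (simp add: field_simps)
  qed
  then have "trace W \<le> (\<Sum>i\<in>(UNIV :: 'n set). 1 / \<mu>)"
    unfolding trace_def by (intro sum_mono)
  then show ?thesis by simp
qed

text \<open>
  The lower bound on the potential with weight \<open>I / L\<close>, read as an upper bound on the determinant.
\<close>

lemma ln_det_hess_le: "ln \<bar>det (hess f z)\<bar> \<le> real CARD('n) * ln L"
proof -
  define W :: "real ^ 'n ^ 'n" where "W = (1 / L) *\<^sub>R mat 1"
  have "real CARD('n) - ln \<bar>det (L *\<^sub>R mat 1 :: real ^ 'n ^ 'n)\<bar> \<le> potential W (hess f z)"
  proof (rule potential_minimal[OF spd_scaleR_mat[OF L_pos] _ spd_hess])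
    show "W ** (L *\<^sub>R mat 1) = mat 1"
      using L_pos by (simp add: W_def matrix_eq matrix_vector_mul_assoc[symmetric]
          scaleR_matrix_vector_assoc[symmetric] matrix_vector_mult_scaleR)
  qed
  moreover have "trace (W ** hess f z) \<le> real CARD('n)"
  proof -
    have "hess f z $ i $ i \<le> L" for i
      using hess_le[of "axis i 1" z] by (simp add: inner_axis' inner_axis matrix_vector_mul_component)
    then have "(\<Sum>i\<in>(UNIV :: 'n set). hess f z $ i $ i / L) \<le> (\<Sum>i\<in>(UNIV :: 'n set). 1)"
      using L_pos by (intro sum_mono) simp
    moreover have "trace (W ** hess f z) = (\<Sum>i\<in>UNIV. hess f z $ i $ i / L)"
      by (simp add: trace_def W_def matrix_matrix_mult_def mat_def if_distrib[of "\<lambda>c. c * _"] if_distrib[of "\<lambda>c. _ * c"]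
          cong: if_cong)
    ultimately show ?thesis by simp
  qed
  ultimately show ?thesis using L_pos by (simp add: potential_def det_scaleR_mat ln_realpow)
qed

text \<open>
  The weight is the inverse Hessian at the minimizer. Of the 6 deviations per iteration one comes from the
  curvature of the update, two from the line search and three from comparing the weighted gradient with the gap.
\<close>

lemma sum_ratio_le:
  "(\<Sum>i<k. ratio i) \<le> real CARD('n) * (\<alpha> / \<mu> - 1 + ln (L / \<alpha>)) + 6 * (\<Sum>i<k. hess_dev (x i))"
proof -
  define W where "W = matrix_inv (hess f xstar)"
  define a where "a i = alignment W (B i) (step i) (grad_change i)" for i
  have "hess f xstar ** W = mat 1"
    unfolding W_def by (rule matrix_inv_right_inverse[OF spd_invertible[OF spd_hess]])
  then have WH: "W ** hess f xstar = mat 1" using matrix_left_right_inverse by blast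
  have W: "spd W" by (rule spd_left_inverse[OF spd_hess WH])
  have "- (real CARD('n) * (\<alpha> / \<mu> - 1 + ln (L / \<alpha>))) - (\<Sum>i<k. hess_dev (x i)) \<le> (\<Sum>i<k. ln (a i))"
    unfolding a_def
  proof (rule sum_ln_alignment_ge[OF spd_hess WH trace_inverse_hess_le[OF WH] ln_det_hess_le])
    fix i
    show "grad_change i \<bullet> (W *v grad_change i) \<le> (1 + hess_dev (x i)) * (step i \<bullet> grad_change i)"
      using curvature_star[OF WH, of "x i" "step i"] f_Suc_le[of i]
      by (simp add: grad_change_def x_plus_step)
  qed
  moreover have "ln (a i) - 5 * hess_dev (x i) \<le> - ratio i" for i
  proof -
    define c where "c = hess_dev (x i)"
    have c: "c \<ge> 0" unfolding c_def by (rule hess_dev_nonneg)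
    have "ln (a i) + ln (2 / (1 + c) ^ 3 / (2 * (1 + 2 * c))) \<le> ln (1 - ratio i)"
      unfolding a_def
    proof (rule ln_one_minus_ratio_ge[OF W])
      show "step i \<bullet> grad_change i \<le> 2 * (1 + 2 * c) * (f (x i) - f (x (Suc i)))"
        using decrease_ge_hess_dev[OF step_exact[of i]]
        by (simp add: c_def grad_change_def x_plus_step)
      show "2 / (1 + c) ^ 3 * gap (x i) \<le> grad f (x i) \<bullet> (W *v grad f (x i))"
        unfolding c_def by (rule gap_le_weighted_grad[OF WH not_optimal])
    qed (use c in auto)
    moreover have "ln (2 / (1 + c) ^ 3 / (2 * (1 + 2 * c))) = - (3 * ln (1 + c) + ln (1 + 2 * c))"
    proof -
      have "2 / p / (2 * r) = 1 / (p * r)" for p r :: real by simp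
      note eq = this[of "(1 + c) ^ 3" "1 + 2 * c"]
      show ?thesis unfolding eq using c by (simp add: ln_div ln_mult_pos ln_realpow)
    qed
    moreover have "ln (1 + c) \<le> c" "ln (1 + 2 * c) \<le> 2 * c"
      using c by (auto intro: ln_add_one_self_le_self)
    moreover have "ln (1 - ratio i) \<le> - ratio i"
      using ln_le_minus_one[OF ratio_less_1[of i]] by simp
    ultimately show ?thesis by (simp add: c_def)
  qed
  then have "(\<Sum>i<k. ln (a i) - 5 * hess_dev (x i)) \<le> (\<Sum>i<k. - ratio i)" by (rule sum_mono)
  ultimately show ?thesis by (simp add: sum_subtractf sum_negf sum_distrib_left[symmetric])
qed

text \<open>
  The additive constants of \<open>sum_hess_dev_le\<close> are absorbed into the last term because
  \<open>L / \<mu> * line_search_const\<close> is at least 2.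
\<close>

theorem superlinear_rate:
  assumes k: "k \<ge> 1"
  shows "gap (x k) / gap (x 0)
    \<le> ((real CARD('n) * (\<alpha> / \<mu> - 1 + ln (L / \<alpha>)) + 8 * hess_dev (x 0) * \<Psi>_L
          + 24 * hess_dev (x 0) * (L / \<mu>) * line_search_const) / real k) ^ k"
  unfolding prod_ratio[symmetric]
proof (rule prod_le_mean_power[OF _ _ k])
  define K where "K = L / \<mu> * line_search_const"
  define R where "R = hess_dev (x 0)"
  have R: "0 \<le> R" unfolding R_def by (rule hess_dev_nonneg)
  have "1 \<le> L / \<mu>" using \<mu>_le_L \<mu>_pos by simp
  then have "2 \<le> K" unfolding K_def using line_search_const_ge mult_mono[of 1 "L / \<mu>" 2 line_search_const] by simp
  then have "\<Psi>_L + 2 + 3 * K \<le> (8 * \<Psi>_L + 24 * K) / 6" using \<Psi>_L_nonneg by simp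
  then have "R * (\<Psi>_L + 2 + 3 * K) \<le> R * ((8 * \<Psi>_L + 24 * K) / 6)"
    using R by (rule mult_left_mono)
  moreover have "(\<Sum>i<k. hess_dev (x i)) \<le> R * (\<Psi>_L + 2 + 3 * K)"
    unfolding R_def K_def by (rule sum_hess_dev_le)
  ultimately have "6 * (\<Sum>i<k. hess_dev (x i)) \<le> R * (8 * \<Psi>_L + 24 * K)" by simp
  then show "(\<Sum>i<k. ratio i) \<le> real CARD('n) * (\<alpha> / \<mu> - 1 + ln (L / \<alpha>)) + 8 * hess_dev (x 0) * \<Psi>_L
      + 24 * hess_dev (x 0) * (L / \<mu>) * line_search_const"
    using sum_ratio_le[of k] by (simp add: R_def K_def algebra_simps)
qed (use ratio_pos less_imp_le in blast)

end

section \<open>The explicit superlinear rate\<close>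

theorem corollary2:
  fixes f :: "real ^ 'n \<Rightarrow> real" and xstar :: "real ^ 'n"
    and x :: "nat \<Rightarrow> real ^ 'n" and B :: "nat \<Rightarrow> real ^ 'n ^ 'n"
    and \<mu> L M \<alpha> \<kappa> C0 d :: real and k :: nat
  assumes "twice_cont_diff f"
    and "\<And>z. f xstar \<le> f z"
    and "\<mu> > 0" and "L > 0" and "M > 0"
    and "strongly_convex \<mu> f"
    and "\<And>y z. norm (grad f y - grad f z) \<le> L * norm (y - z)"
    and "\<And>z. spectral_norm (hess f z - hess f xstar) \<le> M * norm (z - xstar)"
    and "\<alpha> > 0"
    and "B 0 = \<alpha> *\<^sub>R mat 1"
    and "bfgs_exact f x B"
    and "\<And>j. x j \<noteq> xstar"
    and "d = real CARD('n)"
    and "\<kappa> = L / \<mu>"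
    and "C0 = 2 * M / \<mu> powr (3 / 2) * sqrt (2 * (f (x 0) - f xstar))"
    and "k \<ge> 1"
  shows "(f (x k) - f xstar) / (f (x 0) - f xstar)
    \<le> ((d * (\<alpha> / \<mu> - 1 + ln (L / \<alpha>))
          + 4 * C0 * d * (\<alpha> / L - 1 + ln (L / \<alpha>))
          + 12 * C0 * \<kappa> * min (2 * (1 + C0)) (1 + sqrt \<kappa>)) / real k) ^ k"
proof -
  interpret bfgs_run f \<mu> L xstar M x B \<alpha>
    by unfold_locales (use assms in auto)
  have C0: "C0 = 2 * hess_dev (x 0)" by (simp add: assms hess_dev_def gap_def)
  show ?thesis
    using superlinear_rate[OF \<open>k \<ge> 1\<close>]
    by (simp add: C0 \<open>d = _\<close> \<open>\<kappa> = _\<close> gap_def \<Psi>_L_def line_search_const_def mult.assoc)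
qed

end
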